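(* Let $\lambda$ be a weight of $\mathfrak{sl}(n+1)$, $\lambda_i=(\lambda,\alpha_i)$, $i=1,\dots,n$. Let $X^n(\lambda)\in V_\lambda\otimes V_\omega$ be the Bethe vector of weight $\lambda+\omega-\sum_{i=1}^n\alpha_i$, and let $B$ be the Shapovalov form on $V_\lambda\otimes V_\omega$. Then $$B(X^n(\lambda),X^n(\lambda))=\det\left(\frac{\partial^2}{\partial t_i\,\partial t_j}\ln\Phi_n(\lambda,\kappa=1)(t^n)\right)_{i,j=1}^n,$$ where $$\Phi_n(\lambda,\kappa)(t_1,\dots,t_n)=t_1^{-\lambda_1/\kappa}(1-t_1)^{-1/\kappa}\prod_{j=2}^n t_j^{-\lambda_j/\kappa}(t_j-t_{j-1})^{-1/\kappa}$$ is the phase function and $t^n=(t^n_1,\dots,t^n_n)$ is its critical point, given by $$t^n_j=\prod_{i=1}^j\frac{\lambda_i+\dots+\lambda_n+n-i}{\lambda_i+\dots+\lambda_n+n-i+1},\qquad j=1,\dots,n.$$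
   Context: Let $\mathfrak{g}=\mathfrak{sl}(n+1)$ over $\mathbb{C}$ with simple roots $\alpha_1,\dots,\alpha_n$, Chevalley generators $e_i,f_i,h_i$, and invariant form normalized by $(\alpha_i,\alpha_i)=2$. $V_\lambda$ is the Verma module with highest weight $\lambda$ and highest weight vector $v_\lambda$. $V_\omega$ is the linear representation, i.e. the irreducible representation with highest weight $\omega$, $(\omega,\alpha_i)=\delta_{i,1}$, with highest weight vector $v_0$; it has basis $v_0, f_1v_0, f_2f_1v_0,\dots,f_n\cdots f_1v_0$. Shapovalov form: on a highest weight module $V$ with highest weight vector $v$ it is the unique symmetric bilinear form $B$ with $B(e_ix,y)=B(x,f_iy)$ for all $x,y\in V$ and all $i$, and $B(v,v)=1$. On $V_\lambda\otimes V_\omega$ the Shapovalov form is the tensor product of the Shapovalov forms of the factors. Bethe vector: $$X^n(\lambda)=\sum_{k=0}^n\ \sum_{I}\ \omega_{I,k}(t^n)\; f_{i_1}f_{i_2}\cdots f_{i_m}v_\lambda\otimes f_kf_{k-1}\cdots f_1v_0,$$ where $m=n-k$, the inner sum is over all orderings $I=(i_1,\dots,i_m)$ of the set $\{k+1,\dots,n\}$, and $$\omega_{I,k}(t)=\left(\frac{1}{t_{i_m}}\prod_{s=1}^{m-1}\frac1{t_{i_s}-t_{i_{s+1}}}\right)\left(\frac1{t_1-1}\prod_{s=1}^{k-1}\frac{1}{t_{s+1}-t_s}\right),$$ with the first bracket equal to $1$ when $m=0$ and the second bracket equal to $1$ when $k=0$. The vector $X^n(\lambda)$ is singular (annihilated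 by all $e_i$) and spans the one-dimensional space of singular vectors of weight $\lambda+\omega-\sum_{i=1}^n\alpha_i$ in $V_\lambda\otimes V_\omega$. The second partial derivatives of $\ln\Phi_n(\lambda,1)=-\ln(1-t_1)-\sum_{j=1}^n\lambda_j\ln t_j-\sum_{j=2}^n\ln(t_j-t_{j-1})$ are single-valued rational functions, independent of choices of branches. *)

theory Defs
  imports
    "Jordan_Normal_Form.Determinant"
    "HOL-Library.Poly_Mapping"
    "HOL-Combinatorics.Multiset_Permutations"
    "HOL-Analysis.Derivative"
begin

section \<open>The Lie algebra sl(n+1) and its representations\<close>

text \<open>Rows and columns are indexed by 0..n, Chevalley generators and simple roots by 1..n.\<close>

definition sl :: "nat \<Rightarrow> complex mat set" where
  "sl n = {x \<in> carrier_mat (n + 1) (n + 1). (\<Sum>i\<le>n. x $$ (i, i)) = 0}"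

definition bracket :: "complex mat \<Rightarrow> complex mat \<Rightarrow> complex mat" where
  "bracket x y = x * y - y * x"

definition mat_unit :: "nat \<Rightarrow> nat \<Rightarrow> nat \<Rightarrow> complex mat" where
  "mat_unit n r s = Matrix.mat (n + 1) (n + 1) (\<lambda>p. if p = (r, s) then 1 else 0)"

definition chev_e :: "nat \<Rightarrow> nat \<Rightarrow> complex mat" where
  "chev_e n i = mat_unit n (i - 1) i"

definition chev_f :: "nat \<Rightarrow> nat \<Rightarrow> complex mat" where
  "chev_f n i = mat_unit n i (i - 1)"

definition chev_h :: "nat \<Rightarrow> nat \<Rightarrow> complex mat" where
  "chev_h n i = mat_unit n (i - 1) (i - 1) - mat_unit n i i"

definition cartan :: "nat \<Rightarrow> complex mat set" where
  "cartan n = {x \<in> sl n. \<forall>r\<le>n. \<forall>s\<le>n. r \<noteq> s \<longrightarrow> x $$ (r, s) = 0}"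

definition nilp_pos :: "nat \<Rightarrow> complex mat set" where
  "nilp_pos n = {x \<in> sl n. \<forall>r\<le>n. \<forall>s\<le>r. x $$ (r, s) = 0}"

text \<open>A weight is a linear functional on the Cartan subalgebra; values elsewhere are irrelevant.\<close>

definition weight :: "nat \<Rightarrow> (complex mat \<Rightarrow> complex) \<Rightarrow> bool" where
  "weight n lam \<longleftrightarrow>
     (\<forall>x\<in>cartan n. \<forall>y\<in>cartan n. lam (x + y) = lam x + lam y) \<and>
     (\<forall>c. \<forall>x\<in>cartan n. lam (c \<cdot>\<^sub>m x) = c * lam x)"

text \<open>The number \<open>(\<lambda>, \<alpha>\<^sub>i)\<close>: since \<open>(\<alpha>\<^sub>i, \<alpha>\<^sub>i) = 2\<close>, it is the value of \<open>\<lambda>\<close> on the coroot \<open>h\<^sub>i\<close>.\<close>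

definition wt_coord :: "nat \<Rightarrow> (complex mat \<Rightarrow> complex) \<Rightarrow> nat \<Rightarrow> complex" where
  "wt_coord n lam i = lam (chev_h n i)"

definition sl_rep ::
  "nat \<Rightarrow> (complex \<Rightarrow> 'v \<Rightarrow> 'v::ab_group_add) \<Rightarrow> (complex mat \<Rightarrow> 'v \<Rightarrow> 'v) \<Rightarrow> bool" where
  "sl_rep n sc act \<longleftrightarrow> vector_space sc \<and>
     (\<forall>x\<in>sl n. Vector_Spaces.linear sc sc (act x)) \<and>
     (\<forall>x\<in>sl n. \<forall>y\<in>sl n. \<forall>u. act (x + y) u = act x u + act y u) \<and>
     (\<forall>c. \<forall>x\<in>sl n. \<forall>u. act (c \<cdot>\<^sub>m x) u = sc c (act x u)) \<and>
     (\<forall>x\<in>sl n. \<forall>y\<in>sl n. \<forall>u. act (bracket x y) u = act x (act y u) - act y (act x u))"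

definition highest_weight_vector ::
  "nat \<Rightarrow> (complex mat \<Rightarrow> complex) \<Rightarrow> (complex \<Rightarrow> 'v \<Rightarrow> 'v::ab_group_add)
     \<Rightarrow> (complex mat \<Rightarrow> 'v \<Rightarrow> 'v) \<Rightarrow> 'v \<Rightarrow> bool" where
  "highest_weight_vector n lam sc act v \<longleftrightarrow> v \<noteq> 0 \<and>
     (\<forall>x\<in>nilp_pos n. act x v = 0) \<and> (\<forall>h\<in>cartan n. act h v = sc (lam h) v)"

definition irreducible_rep ::
  "nat \<Rightarrow> (complex \<Rightarrow> 'v \<Rightarrow> 'v::ab_group_add) \<Rightarrow> (complex mat \<Rightarrow> 'v \<Rightarrow> 'v) \<Rightarrow> bool" where
  "irreducible_rep n sc act \<longleftrightarrow> sl_rep n sc act \<and> (\<exists>u::'v. u \<noteq> 0) \<and>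
     (\<forall>S. module.subspace sc S \<and> (\<forall>x\<in>sl n. \<forall>u\<in>S. act x u \<in> S) \<longrightarrow> S = {0} \<or> S = UNIV)"

definition irreducible_hw_rep ::
  "nat \<Rightarrow> (complex mat \<Rightarrow> complex) \<Rightarrow> (complex \<Rightarrow> 'v \<Rightarrow> 'v::ab_group_add)
     \<Rightarrow> (complex mat \<Rightarrow> 'v \<Rightarrow> 'v) \<Rightarrow> 'v \<Rightarrow> bool" where
  "irreducible_hw_rep n lam sc act v \<longleftrightarrow>
     irreducible_rep n sc act \<and> highest_weight_vector n lam sc act v"

section \<open>Verma modules\<close>

text \<open>
  The Verma module is \<open>U(g) / (U(g) n\<^sub>+ + \<Sum>\<^sub>h U(g) (h - \<lambda>(h)))\<close>, with highest weight vector the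
  class of 1. Elements of \<open>U(g)\<close> are represented by noncommutative polynomials in the elements of
  \<open>g\<close>, i.e. finitely supported functions on words over \<open>g\<close>; \<open>U(g)\<close> is the quotient by the
  two-sided ideal spanned by \<open>env_relations\<close>. The Verma module is then characterized up to
  isomorphism: evaluating polynomials on \<open>v\<close> is onto, with kernel exactly the span of
  \<open>env_relations\<close> and \<open>hw_relations\<close>.
\<close>

type_synonym nc_poly = "complex mat list \<Rightarrow>\<^sub>0 complex"

definition nc_scale :: "complex \<Rightarrow> nc_poly \<Rightarrow> nc_poly" where
  "nc_scale c p = Poly_Mapping.map (\<lambda>a. c * a) p"

abbreviation word :: "complex mat list \<Rightarrow> nc_poly" where
  "word w \<equiv> Poly_Mapping.single w 1"

definition nc_polys :: "nat \<Rightarrow> nc_poly set" where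
  "nc_polys n = {p. Poly_Mapping.keys p \<subseteq> lists (sl n)}"

definition env_relations :: "nat \<Rightarrow> nc_poly set" where
  "env_relations n =
     {word (a @ [x + y] @ b) - word (a @ [x] @ b) - word (a @ [y] @ b) | a b x y.
        a \<in> lists (sl n) \<and> b \<in> lists (sl n) \<and> x \<in> sl n \<and> y \<in> sl n} \<union>
     {word (a @ [c \<cdot>\<^sub>m x] @ b) - nc_scale c (word (a @ [x] @ b)) | a b c x.
        a \<in> lists (sl n) \<and> b \<in> lists (sl n) \<and> x \<in> sl n} \<union>
     {word (a @ [x, y] @ b) - word (a @ [y, x] @ b) - word (a @ [bracket x y] @ b) | a b x y.
        a \<in> lists (sl n) \<and> b \<in> lists (sl n) \<and> x \<in> sl n \<and> y \<in> sl n}"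

definition hw_relations :: "nat \<Rightarrow> (complex mat \<Rightarrow> complex) \<Rightarrow> nc_poly set" where
  "hw_relations n lam =
     {word (a @ [x]) | a x. a \<in> lists (sl n) \<and> x \<in> nilp_pos n} \<union>
     {word (a @ [h]) - nc_scale (lam h) (word a) | a h. a \<in> lists (sl n) \<and> h \<in> cartan n}"

definition nc_eval ::
  "(complex \<Rightarrow> 'v \<Rightarrow> 'v::ab_group_add) \<Rightarrow> (complex mat \<Rightarrow> 'v \<Rightarrow> 'v) \<Rightarrow> 'v \<Rightarrow> nc_poly \<Rightarrow> 'v" where
  "nc_eval sc act v p =
     (\<Sum>w\<in>Poly_Mapping.keys p. sc (Poly_Mapping.lookup p w) (foldr act w v))"

definition verma_module ::
  "nat \<Rightarrow> (complex mat \<Rightarrow> complex) \<Rightarrow> (complex \<Rightarrow> 'v \<Rightarrow> 'v::ab_group_add)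
     \<Rightarrow> (complex mat \<Rightarrow> 'v \<Rightarrow> 'v) \<Rightarrow> 'v \<Rightarrow> bool" where
  "verma_module n lam sc act v \<longleftrightarrow> sl_rep n sc act \<and>
     nc_eval sc act v ` nc_polys n = UNIV \<and>
     {p \<in> nc_polys n. nc_eval sc act v p = 0}
       = module.span nc_scale (env_relations n \<union> hw_relations n lam)"

section \<open>Bilinear forms, tensor products and Shapovalov forms\<close>

definition bilinear_map ::
  "(complex \<Rightarrow> 'u \<Rightarrow> 'u::ab_group_add) \<Rightarrow> (complex \<Rightarrow> 'v \<Rightarrow> 'v::ab_group_add)
     \<Rightarrow> (complex \<Rightarrow> 'w \<Rightarrow> 'w::ab_group_add) \<Rightarrow> ('u \<Rightarrow> 'v \<Rightarrow> 'w) \<Rightarrow> bool" where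
  "bilinear_map su sv sw b \<longleftrightarrow>
     (\<forall>y. Vector_Spaces.linear su sw (\<lambda>x. b x y)) \<and>
     (\<forall>x. Vector_Spaces.linear sv sw (\<lambda>y. b x y))"

definition bilinear_form ::
  "(complex \<Rightarrow> 'v \<Rightarrow> 'v::ab_group_add) \<Rightarrow> ('v \<Rightarrow> 'v \<Rightarrow> complex) \<Rightarrow> bool" where
  "bilinear_form sc b \<longleftrightarrow> bilinear_map sc sc (*) b"

text \<open>
  The universal property of the tensor product. Over a field it is enough to require it for
  scalar-valued bilinear maps: uniqueness of the factorization makes the pure tensors span, and
  its existence makes \<open>x\<^sub>i \<otimes> y\<^sub>j\<close> linearly independent for linearly independent \<open>x\<^sub>i\<close> and \<open>y\<^sub>j\<close>.
\<close>

definition tensor_product ::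
  "(complex \<Rightarrow> 'u \<Rightarrow> 'u::ab_group_add) \<Rightarrow> (complex \<Rightarrow> 'v \<Rightarrow> 'v::ab_group_add)
     \<Rightarrow> (complex \<Rightarrow> 'w \<Rightarrow> 'w::ab_group_add) \<Rightarrow> ('u \<Rightarrow> 'v \<Rightarrow> 'w) \<Rightarrow> bool" where
  "tensor_product su sv sw ten \<longleftrightarrow> bilinear_map su sv sw ten \<and>
     (\<forall>b. bilinear_map su sv (*) b \<longrightarrow>
        (\<exists>!g. Vector_Spaces.linear sw (*) g \<and> (\<forall>x y. g (ten x y) = b x y)))"

definition shapovalov_form ::
  "nat \<Rightarrow> (complex \<Rightarrow> 'v \<Rightarrow> 'v::ab_group_add) \<Rightarrow> (complex mat \<Rightarrow> 'v \<Rightarrow> 'v) \<Rightarrow> 'v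
     \<Rightarrow> ('v \<Rightarrow> 'v \<Rightarrow> complex) \<Rightarrow> bool" where
  "shapovalov_form n sc act v b \<longleftrightarrow> bilinear_form sc b \<and> (\<forall>x y. b x y = b y x) \<and>
     (\<forall>i\<in>{1..n}. \<forall>x y. b (act (chev_e n i) x) y = b x (act (chev_f n i) y)) \<and> b v v = 1"

definition tensor_form ::
  "(complex \<Rightarrow> 'w \<Rightarrow> 'w::ab_group_add) \<Rightarrow> ('u \<Rightarrow> 'v \<Rightarrow> 'w)
     \<Rightarrow> ('u \<Rightarrow> 'u \<Rightarrow> complex) \<Rightarrow> ('v \<Rightarrow> 'v \<Rightarrow> complex) \<Rightarrow> ('w \<Rightarrow> 'w \<Rightarrow> complex) \<Rightarrow> bool" where
  "tensor_form sw ten b1 b2 b \<longleftrightarrow> bilinear_form sw b \<and>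
     (\<forall>x y x' y'. b (ten x y) (ten x' y') = b1 x x' * b2 y y')"

section \<open>The Bethe vector\<close>

definition bethe_weight :: "nat list \<Rightarrow> nat \<Rightarrow> (nat \<Rightarrow> complex) \<Rightarrow> complex" where
  "bethe_weight I k t =
     (if I = [] then 1
      else 1 / t (last I) * (\<Prod>s<length I - 1. 1 / (t (I ! s) - t (I ! (s + 1))))) *
     (if k = 0 then 1
      else 1 / (t 1 - 1) * (\<Prod>s\<in>{1..k - 1}. 1 / (t (s + 1) - t s)))"

text \<open>\<open>f_word n act [i\<^sub>1, \<dots>, i\<^sub>m] u\<close> is \<open>f\<^bsub>i\<^sub>1\<^esub> \<cdots> f\<^bsub>i\<^sub>m\<^esub> u\<close>.\<close>

definition f_word :: "nat \<Rightarrow> (complex mat \<Rightarrow> 'v \<Rightarrow> 'v) \<Rightarrow> nat list \<Rightarrow> 'v \<Rightarrow> 'v" where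
  "f_word n act I u = foldr (\<lambda>i. act (chev_f n i)) I u"

definition bethe_vector ::
  "nat \<Rightarrow> (complex \<Rightarrow> 'w \<Rightarrow> 'w::ab_group_add) \<Rightarrow> ('u \<Rightarrow> 'v \<Rightarrow> 'w)
     \<Rightarrow> (complex mat \<Rightarrow> 'u \<Rightarrow> 'u) \<Rightarrow> 'u \<Rightarrow> (complex mat \<Rightarrow> 'v \<Rightarrow> 'v) \<Rightarrow> 'v
     \<Rightarrow> (nat \<Rightarrow> complex) \<Rightarrow> 'w" where
  "bethe_vector n sw ten act1 v act2 v0 t =
     (\<Sum>k\<le>n. \<Sum>I\<in>permutations_of_set {k + 1..n}.
        sw (bethe_weight I k t)
           (ten (f_word n act1 I v) (f_word n act2 (rev [1..<k + 1]) v0)))"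

section \<open>The phase function and its critical point\<close>

text \<open>A branch of the logarithm near a point.\<close>

definition log_branch_at :: "complex \<Rightarrow> (complex \<Rightarrow> complex) \<Rightarrow> bool" where
  "log_branch_at p L \<longleftrightarrow>
     (\<exists>U. open U \<and> p \<in> U \<and> continuous_on U L \<and> (\<forall>z\<in>U. exp (L z) = z))"

text \<open>
  The branch of the phase function determined by a branch of the logarithm for each of its factors:
  \<open>L j\<close> for \<open>t\<^sub>j\<close>, \<open>M 1\<close> for \<open>1 - t\<^sub>1\<close> and \<open>M j\<close> for \<open>t\<^sub>j - t\<^bsub>j-1\<^esub>\<close>, \<open>j \<ge> 2\<close>.
\<close>

definition phase ::
  "nat \<Rightarrow> (nat \<Rightarrow> complex) \<Rightarrow> complex \<Rightarrow> (nat \<Rightarrow> complex \<Rightarrow> complex) \<Rightarrow> (nat \<Rightarrow> complex \<Rightarrow> complex)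
     \<Rightarrow> (nat \<Rightarrow> complex) \<Rightarrow> complex" where
  "phase n l \<kappa> L M t =
     exp (- (l 1 / \<kappa>) * L 1 (t 1)) * exp (- (1 / \<kappa>) * M 1 (1 - t 1)) *
     (\<Prod>j\<in>{2..n}. exp (- (l j / \<kappa>) * L j (t j)) * exp (- (1 / \<kappa>) * M j (t j - t (j - 1))))"

definition ln_phase ::
  "nat \<Rightarrow> (nat \<Rightarrow> complex) \<Rightarrow> complex \<Rightarrow> (nat \<Rightarrow> complex \<Rightarrow> complex) \<Rightarrow> (nat \<Rightarrow> complex \<Rightarrow> complex)
     \<Rightarrow> (nat \<Rightarrow> complex) \<Rightarrow> complex" where
  "ln_phase n l \<kappa> L M t =
     - (1 / \<kappa>) * M 1 (1 - t 1) - (\<Sum>j\<in>{1..n}. l j / \<kappa> * L j (t j))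
     - (\<Sum>j\<in>{2..n}. 1 / \<kappa> * M j (t j - t (j - 1)))"

lemma exp_ln_phase:
  assumes "n \<ge> 1"
  shows "exp (ln_phase n l \<kappa> L M t) = phase n l \<kappa> L M t"
proof -
  have "{1..n} = insert 1 {2..n}" using assms by auto
  then have "ln_phase n l \<kappa> L M t =
     - (l 1 / \<kappa>) * L 1 (t 1) + - (1 / \<kappa>) * M 1 (1 - t 1) +
     (\<Sum>j\<in>{2..n}. - (l j / \<kappa>) * L j (t j) + - (1 / \<kappa>) * M j (t j - t (j - 1)))"
    unfolding ln_phase_def by (simp add: sum_subtractf sum_negf)
  then show ?thesis
    unfolding phase_def by (simp only: exp_add exp_sum finite_atLeastAtMost)
qed

definition partial_deriv ::
  "nat \<Rightarrow> ((nat \<Rightarrow> complex) \<Rightarrow> complex) \<Rightarrow> (nat \<Rightarrow> complex) \<Rightarrow> complex" where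
  "partial_deriv i F t = deriv (\<lambda>z. F (t(i := z))) (t i)"

text \<open>The indices of the n x n Hessian are shifted by one, as matrices are indexed from 0.\<close>

definition hessian :: "nat \<Rightarrow> ((nat \<Rightarrow> complex) \<Rightarrow> complex) \<Rightarrow> (nat \<Rightarrow> complex) \<Rightarrow> complex mat" where
  "hessian n F t =
     Matrix.mat n n (\<lambda>(i, j). partial_deriv (i + 1) (partial_deriv (j + 1) F) t)"

definition crit_point :: "nat \<Rightarrow> (nat \<Rightarrow> complex) \<Rightarrow> nat \<Rightarrow> complex" where
  "crit_point n l j =
     (\<Prod>i\<in>{1..j}. ((\<Sum>s\<in>{i..n}. l s) + of_nat n - of_nat i) /
                   ((\<Sum>s\<in>{i..n}. l s) + of_nat n - of_nat i + 1))"

end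

theory Submission
  imports Defs
begin

text \<open>
  The Bethe vector splits as \<open>X = \<Sum>\<^sub>q Y\<^sub>q \<otimes> f\<^sub>q \<cdots> f\<^sub>1 v\<^sub>0\<close>, and the vectors
  \<open>f\<^sub>q \<cdots> f\<^sub>1 v\<^sub>0\<close> are orthonormal. Partial fractions turn the critical point equations into
  \<open>e\<^sub>i Y\<^sub>q = - \<delta>\<^bsub>i,q+1\<^esub> Y\<^bsub>q+1\<^esub>\<close> for \<open>i > q\<close>. Moving the \<open>f\<^sub>i\<close> of one argument of the form
  to the other one as \<open>e\<^sub>i\<close>, only the ordering \<open>q+1, \<dots>, n\<close> survives in \<open>B(Y\<^sub>q, Y\<^sub>q)\<close>, and the sum over
  \<open>q\<close> telescopes to \<open>D\<^sup>2 / t\<^sub>n\<close> with \<open>D = \<Prod>\<^sub>s 1 / (t\<^sub>s - t\<^bsub>s-1\<^esub>)\<close> and \<open>t\<^sub>0 = 1\<close>. The Hessian is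
  tridiagonal, and eliminating from the last row upwards gives it the pivots
  \<open>a\<^sub>i (a\<^sub>i - 1) / t\<^sub>i\<^sup>2\<close>, where \<open>t\<^sub>i = t\<^bsub>i-1\<^esub> (a\<^sub>i - 1) / a\<^sub>i\<close>; their product is \<open>D\<^sup>2 / t\<^sub>n\<close> as well.
\<close>

lemma linear_map_simps:
  assumes "Vector_Spaces.linear s1 s2 g"
  shows "g (x + y) = g x + g y" "g (s1 c x) = s2 c (g x)" "g 0 = 0"
    "g (sum k S) = (\<Sum>i\<in>S. g (k i))"
proof -
  interpret Vector_Spaces.linear s1 s2 g by fact
  show "g (x + y) = g x + g y" "g (s1 c x) = s2 c (g x)" "g 0 = 0"
    "g (sum k S) = (\<Sum>i\<in>S. g (k i))"
    by (rule add scale zero sum)+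
qed

section \<open>Chevalley generators\<close>

definition cartan_entry :: "nat \<Rightarrow> nat \<Rightarrow> complex" where
  "cartan_entry i j = (if i = j then 2 else if i = Suc j \<or> j = Suc i then -1 else 0)"

lemma mat_unit_carrier [simp]: "mat_unit n r s \<in> carrier_mat (Suc n) (Suc n)"
  by (simp add: mat_unit_def)

lemma mat_unit_dim [simp]: "dim_row (mat_unit n r s) = Suc n" "dim_col (mat_unit n r s) = Suc n"
  by (simp_all add: mat_unit_def)

lemma mat_unit_index [simp]:
  "a \<le> n \<Longrightarrow> b \<le> n \<Longrightarrow> mat_unit n r s $$ (a, b) = (if a = r \<and> b = s then 1 else 0)"
  by (simp add: mat_unit_def)

lemma mat_unit_mult:
  assumes "s \<le> n"
  shows "mat_unit n r s * mat_unit n p q = (if s = p then mat_unit n r q else 0\<^sub>m (n + 1) (n + 1))"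
proof (rule eq_matI)
  fix a b assume "a < dim_row (if s = p then mat_unit n r q else 0\<^sub>m (n + 1) (n + 1))"
    "b < dim_col (if s = p then mat_unit n r q else 0\<^sub>m (n + 1) (n + 1))"
  then have ab: "a \<le> n" "b \<le> n" by (auto split: if_splits)
  have "(mat_unit n r s * mat_unit n p q) $$ (a, b)
      = (\<Sum>k<Suc n. mat_unit n r s $$ (a, k) * mat_unit n p q $$ (k, b))"
    using ab by (simp add: scalar_prod_def atLeast0LessThan del: sum.lessThan_Suc)
  also have "\<dots> = (\<Sum>k<Suc n. if k = s then (if a = r \<and> s = p \<and> b = q then 1 else 0) else 0)"
    using ab by (intro sum.cong) (auto simp: less_Suc_eq_le)
  also have "\<dots> = (if a = r \<and> s = p \<and> b = q then 1 else 0)"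
    using assms by (simp del: sum.lessThan_Suc)
  finally show "(mat_unit n r s * mat_unit n p q) $$ (a, b)
      = (if s = p then mat_unit n r q else 0\<^sub>m (n + 1) (n + 1)) $$ (a, b)"
    using ab by simp
qed auto

lemma chev_carrier [simp]:
  "chev_e n i \<in> carrier_mat (Suc n) (Suc n)" "chev_f n i \<in> carrier_mat (Suc n) (Suc n)"
  "chev_h n i \<in> carrier_mat (Suc n) (Suc n)"
  by (auto simp: chev_e_def chev_f_def chev_h_def)

lemma chev_nilp_pos: "i \<in> {1..n} \<Longrightarrow> chev_e n i \<in> nilp_pos n"
  by (auto simp: nilp_pos_def sl_def chev_e_def intro!: sum.neutral)

lemma chev_h_index:
  assumes "r \<le> n" "s \<le> n"
  shows "chev_h n i $$ (r, s)
    = (if r = i - 1 \<and> s = i - 1 then 1 else 0) - (if r = i \<and> s = i then 1 else 0)"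
  using assms by (simp add: chev_h_def)

lemma chev_cartan:
  assumes "i \<in> {1..n}"
  shows "chev_h n i \<in> cartan n"
proof -
  have "i - 1 \<le> n" "i \<le> n" using assms by auto
  have "(\<Sum>a\<le>n. chev_h n i $$ (a, a)) = (\<Sum>a\<le>n. (if a = i - 1 then 1 else 0) - (if a = i then 1 else 0))"
    by (intro sum.cong refl) (simp add: chev_h_index)
  also have "\<dots> = 0"
    using \<open>i - 1 \<le> n\<close> \<open>i \<le> n\<close> by (simp add: sum_subtractf)
  finally have "chev_h n i \<in> sl n" by (simp add: sl_def)
  moreover have "chev_h n i $$ (r, s) = 0" if "r \<le> n" "s \<le> n" "r \<noteq> s" for r s
    using that(3) unfolding chev_h_index[OF that(1,2)] by auto
  ultimately show ?thesis by (simp add: cartan_def)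
qed

lemma chev_sl:
  assumes "i \<in> {1..n}"
  shows "chev_e n i \<in> sl n" "chev_f n i \<in> sl n" "chev_h n i \<in> sl n"
  using assms chev_nilp_pos[OF assms] chev_cartan[OF assms]
  by (auto simp: nilp_pos_def cartan_def sl_def chev_f_def intro!: sum.neutral split: if_splits)

text \<open>The case distinction sits in the scalar, so that \<open>act_smult\<close> turns it into
  a coefficient on vectors.\<close>

lemma bracket_e_f:
  assumes "i \<in> {1..n}" "j \<in> {1..n}"
  shows "bracket (chev_e n i) (chev_f n j) = (if i = j then 1 else 0) \<cdot>\<^sub>m chev_h n i"
proof -
  have "chev_e n i * chev_f n j
      = (if i = j then mat_unit n (i - 1) (i - 1) else 0\<^sub>m (n + 1) (n + 1))"
    "chev_f n j * chev_e n i = (if i = j then mat_unit n i i else 0\<^sub>m (n + 1) (n + 1))"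
    using assms by (auto simp: chev_e_def chev_f_def mat_unit_mult)
  then show ?thesis
    by (intro eq_matI) (auto simp: bracket_def chev_h_def)
qed

lemma bracket_h_f:
  assumes "i \<in> {1..n}" "j \<in> {1..n}"
  shows "bracket (chev_h n i) (chev_f n j) = (- cartan_entry i j) \<cdot>\<^sub>m chev_f n j"
proof -
  have "chev_h n i * chev_f n j
      = mat_unit n (i - 1) (i - 1) * mat_unit n j (j - 1) - mat_unit n i i * mat_unit n j (j - 1)"
    unfolding chev_h_def chev_f_def
    by (rule minus_mult_distrib_mat[of _ "Suc n" "Suc n" _ _ "Suc n"]) simp_all
  moreover have "chev_f n j * chev_h n i
      = mat_unit n j (j - 1) * mat_unit n (i - 1) (i - 1) - mat_unit n j (j - 1) * mat_unit n i i"
    unfolding chev_h_def chev_f_def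
    by (rule mult_minus_distrib_mat[of _ "Suc n" "Suc n" _ "Suc n"]) simp_all
  ultimately have
    "chev_h n i * chev_f n j = (if i = Suc j then chev_f n j else 0\<^sub>m (n + 1) (n + 1))
      - (if i = j then chev_f n j else 0\<^sub>m (n + 1) (n + 1))"
    "chev_f n j * chev_h n i = (if i = j then chev_f n j else 0\<^sub>m (n + 1) (n + 1))
      - (if j = Suc i then chev_f n j else 0\<^sub>m (n + 1) (n + 1))"
    using assms by (auto simp: mat_unit_mult chev_f_def)
  then show ?thesis
    unfolding bracket_def by (intro eq_matI) (auto simp: chev_f_def cartan_entry_def)
qed

section \<open>Words in the lowering operators\<close>

text \<open>What the Verma module and the linear representation have in common, so that the word
  calculus below serves both tensor factors.\<close>

locale highest_weight_rep =
  fixes n :: nat and lam :: "complex mat \<Rightarrow> complex"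
    and sc :: "complex \<Rightarrow> 'v \<Rightarrow> 'v::ab_group_add"
    and act :: "complex mat \<Rightarrow> 'v \<Rightarrow> 'v" and v :: 'v
  assumes rep: "sl_rep n sc act"
    and nilp_pos_v: "x \<in> nilp_pos n \<Longrightarrow> act x v = 0"
    and cartan_v: "h \<in> cartan n \<Longrightarrow> act h v = sc (lam h) v"
begin

sublocale vector_space sc
  using rep by (simp add: sl_rep_def)

abbreviation "e i \<equiv> act (chev_e n i)"
abbreviation "f i \<equiv> act (chev_f n i)"
abbreviation "h i \<equiv> act (chev_h n i)"
abbreviation "F I \<equiv> f_word n act I v"

lemma linear_act: "x \<in> sl n \<Longrightarrow> Vector_Spaces.linear sc sc (act x)"
  using rep by (auto simp: sl_rep_def)

lemma act_scale: "x \<in> sl n \<Longrightarrow> act x (sc c u) = sc c (act x u)"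
  by (rule linear_map_simps[OF linear_act])

lemma act_smult: "x \<in> sl n \<Longrightarrow> act (c \<cdot>\<^sub>m x) u = sc c (act x u)"
  using rep by (auto simp: sl_rep_def)

lemma act_bracket:
  "x \<in> sl n \<Longrightarrow> y \<in> sl n \<Longrightarrow> act x (act y u) = act y (act x u) + act (bracket x y) u"
  using rep by (auto simp: sl_rep_def)

lemma F_simps [simp]: "F [] = v" "F (i # I) = f i (F I)"
  by (simp_all add: f_word_def)

text \<open>Commuting past the letter \<open>j\<close> lowers the weight by the root alpha_j, so
  words are weight vectors.\<close>

lemma h_F:
  assumes "i \<in> {1..n}" "set I \<subseteq> {1..n}"
  shows "h i (F I) = sc (wt_coord n lam i - (\<Sum>j\<leftarrow>I. cartan_entry i j)) (F I)"
  using assms(2)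
proof (induction I)
  case Nil
  then show ?case
    using assms cartan_v[OF chev_cartan] by (simp add: wt_coord_def)
next
  case (Cons j I)
  then have j: "j \<in> {1..n}" by auto
  have "h i (f j (F I)) = f j (h i (F I)) + act (bracket (chev_h n i) (chev_f n j)) (F I)"
    using act_bracket chev_sl assms j by blast
  also have "\<dots> = sc (wt_coord n lam i - (\<Sum>j\<leftarrow>I. cartan_entry i j)) (f j (F I))
      + sc (- cartan_entry i j) (f j (F I))"
    using Cons.IH Cons.prems act_scale[OF chev_sl(2)[OF j]] act_smult[OF chev_sl(2)[OF j]]
    by (simp add: bracket_h_f[OF assms(1) j])
  also have "\<dots> = sc (wt_coord n lam i - (\<Sum>j\<leftarrow>j # I. cartan_entry i j)) (f j (F I))"
    by (simp add: algebra_simps flip: scale_left_distrib)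
  finally show ?case by simp
qed

lemma e_F_Nil: "i \<in> {1..n} \<Longrightarrow> e i (F []) = 0"
  using nilp_pos_v chev_nilp_pos by simp

text \<open>The commutator of e_i and f_j is h_i for \<open>i = j\<close> and 0 otherwise, and h_i
  acts on the remaining word by its weight.\<close>

lemma e_F_Cons:
  assumes "i \<in> {1..n}" "set (j # I) \<subseteq> {1..n}"
  shows "e i (F (j # I)) = f j (e i (F I))
    + (if i = j then sc (wt_coord n lam i - (\<Sum>j\<leftarrow>I. cartan_entry i j)) (F I) else 0)"
proof -
  have j: "j \<in> {1..n}" using assms by auto
  have "e i (f j (F I)) = f j (e i (F I)) + act (bracket (chev_e n i) (chev_f n j)) (F I)"
    using act_bracket chev_sl assms j by blast
  then show ?thesis
    using assms j by (simp add: bracket_e_f act_smult chev_sl h_F)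
qed

lemma f_zero: "i \<in> {1..n} \<Longrightarrow> f i 0 = 0"
  by (rule linear_map_simps[OF linear_act[OF chev_sl(2)]])

lemma e_F_notin:
  assumes "i \<in> {1..n}" "set I \<subseteq> {1..n}" "i \<notin> set I"
  shows "e i (F I) = 0"
  using assms(2,3)
proof (induction I)
  case (Cons j I)
  then show ?case
    using assms(1) by (simp only: e_F_Cons) (auto simp: f_zero)
qed (use assms(1) e_F_Nil in simp)

text \<open>Only the single occurrence of \<open>i\<close> gives a commutator. The resulting h_i
  sees just the letters to its right, so e_i deletes the letter and leaves a scalar depending on
  \<open>J\<close>.\<close>

lemma e_F_append:
  assumes "i \<in> {1..n}" "set (I @ i # J) \<subseteq> {1..n}" "i \<notin> set I" "i \<notin> set J"
  shows "e i (F (I @ i # J)) = sc (wt_coord n lam i - (\<Sum>j\<leftarrow>J. cartan_entry i j)) (F (I @ J))"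
  using assms(2,3)
proof (induction I)
  case Nil
  then show ?case
    using assms by (simp only: append_Nil e_F_Cons) (simp add: e_F_notin f_zero)
next
  case (Cons j I)
  then have "j \<in> {1..n}" "i \<noteq> j" by auto
  then show ?case
    using assms(1) Cons by (simp only: append_Cons e_F_Cons) (simp add: act_scale chev_sl)
qed

section \<open>Contravariance of the Shapovalov form on words\<close>

context
  fixes B
  assumes B: "shapovalov_form n sc act v B"
begin

lemma form_linear: "Vector_Spaces.linear sc (*) (\<lambda>x. B x y)" "Vector_Spaces.linear sc (*) (B x)"
  using B by (auto simp: shapovalov_form_def bilinear_form_def bilinear_map_def)

lemma form_add: "B (x + x') y = B x y + B x' y" "B x (y + y') = B x y + B x y'"
  by (rule linear_map_simps[OF form_linear(1)] linear_map_simps[OF form_linear(2)])+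

lemma form_scale: "B (sc c x) y = c * B x y" "B x (sc c y) = c * B x y"
  by (rule linear_map_simps[OF form_linear(1)] linear_map_simps[OF form_linear(2)])+

lemma form_zero: "B 0 y = 0" "B x 0 = 0"
  by (rule linear_map_simps[OF form_linear(1)] linear_map_simps[OF form_linear(2)])+

lemma form_sum: "B (sum g S) y = (\<Sum>i\<in>S. B (g i) y)"
  by (rule linear_map_simps[OF form_linear(1)])

lemma form_sym: "B x y = B y x"
  using B by (auto simp: shapovalov_form_def)

lemma form_e: "i \<in> {1..n} \<Longrightarrow> B (e i x) y = B x (f i y)"
  using B by (auto simp: shapovalov_form_def)

lemma form_f: "i \<in> {1..n} \<Longrightarrow> B (f i x) y = B x (e i y)"
  using form_e form_sym by metis

lemma form_v: "B v v = 1"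
  using B by (auto simp: shapovalov_form_def)

text \<open>A coarse form of the orthogonality of distinct weight spaces: contravariance strips one
  letter from each word at a time, until the shorter one is \<open>v\<close> and an e_j meets
  it.\<close>

lemma form_F_length:
  assumes "set I \<subseteq> {1..n}" "set J \<subseteq> {1..n}" "length I \<noteq> length J"
  shows "B (F I) (F J) = 0"
  using assms
proof (induction I arbitrary: J)
  case Nil
  then obtain j J' where "J = j # J'" by (cases J) auto
  with Nil show ?case
    using form_f[of j "F J'" v] by (simp add: form_sym[of v] form_zero e_F_Nil[simplified])
next
  case (Cons i I)
  then have i: "i \<in> {1..n}" by auto
  \<comment> \<open>Applying e_i to a word gives a combination of words one letter shorter. This is
    phrased through orthogonality to them, for every \<open>x\<close>, because the leading f_j of
    \<open>J\<close> passes to \<open>x\<close> as e_j.\<close>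
  have "B x (e i (F J)) = 0"
    if "set J \<subseteq> {1..n}" "\<And>J'. set J' \<subseteq> {1..n} \<Longrightarrow> Suc (length J') = length J \<Longrightarrow> B x (F J') = 0"
    for J x
    using that
  proof (induction J arbitrary: x)
    case Nil
    then show ?case using i by (simp add: e_F_Nil[simplified] form_zero)
  next
    case (Cons j J)
    have j: "j \<in> {1..n}" using Cons by auto
    have "B (e j x) (e i (F J)) = 0"
    proof (rule Cons.IH)
      fix J' assume J': "set J' \<subseteq> {1..n}" "Suc (length J') = length J"
      then have "B x (F (j # J')) = 0"
        using j by (intro Cons.prems(2)) auto
      then show "B (e j x) (F J') = 0" by (simp add: form_e[OF j])
    qed (use Cons.prems(1) in auto)
    then have "B x (f j (e i (F J))) = 0" by (simp add: form_e[OF j])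
    moreover have "B x (F J) = 0" using Cons.prems by simp
    ultimately show ?case
      unfolding e_F_Cons[OF i Cons.prems(1)] by (simp add: form_add form_scale form_zero)
  qed
  then have "B (F I) (e i (F J)) = 0"
    using Cons by (auto intro!: Cons.IH)
  then show ?case using i by (simp add: form_f)
qed

end

end

section \<open>Partial fractions along words\<close>

text \<open>The first bracket of omega_{I,k}, peeled off from the left. The last factor is a
  difference too, as if a further letter with parameter 0 followed the word.\<close>

fun chain_weight :: "(nat \<Rightarrow> 'a::field) \<Rightarrow> nat list \<Rightarrow> 'a" where
  "chain_weight t [] = 1"
| "chain_weight t [a] = 1 / t a"
| "chain_weight t (a # b # I) = chain_weight t (b # I) / (t a - t b)"

lemma chain_weight_eq:
  "I \<noteq> [] \<Longrightarrow>
    chain_weight t I = 1 / t (last I) * (\<Prod>s<length I - 1. 1 / (t (I ! s) - t (I ! (s + 1))))"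
  by (induction t I rule: chain_weight.induct)
    (simp_all add: prod.lessThan_Suc_shift del: prod.lessThan_Suc)

definition insert_at :: "nat \<Rightarrow> 'a \<Rightarrow> 'a list \<Rightarrow> 'a list" where
  "insert_at p x I = take p I @ x # drop p I"

lemma mset_insert_at: "mset (insert_at p x xs) = mset (x # xs)"
proof -
  have "mset (take p xs) + mset (drop p xs) = mset xs"
    by (metis append_take_drop_id mset_append)
  then show ?thesis by (simp add: insert_at_def)
qed

lemma set_insert_at: "set (insert_at p x xs) = insert x (set xs)"
  using mset_eq_setD[OF mset_insert_at] by simp

lemma distinct_insert_at: "distinct (insert_at p x xs) \<longleftrightarrow> x \<notin> set xs \<and> distinct xs"
  using mset_eq_imp_distinct_iff[OF mset_insert_at] by simp

text \<open>Inserting \<open>i\<close> between \<open>b\<close> and \<open>r\<close> is the partial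
  fraction 1/((t_b - t_i)(t_i - t_r)) = (1/(t_i - t_r) - 1/(t_i - t_b)) / (t_b - t_r). Thus
  \<open>g p\<close> belongs to the right neighbour and \<open>g (p - 1)\<close> to the left one;
  the parameter past the end is 0, and position 0 has no left neighbour.\<close>

lemma chain_weight_insert_at:
  assumes "distinct (i # J)" "inj_on t (set (i # J))" "0 \<notin> t ` set (i # J)" "p \<le> length J"
  defines "g \<equiv> \<lambda>p. 1 / (t i - (if p < length J then t (J ! p) else 0))"
  shows "chain_weight t (insert_at p i J) = chain_weight t J * (g p - (if p = 0 then 0 else g (p - 1)))"
  using assms(1-4) unfolding g_def
proof (induction J arbitrary: p)
  case Nil
  then show ?case by (simp add: insert_at_def)
next
  case (Cons b R)
  have ib: "t i \<noteq> t b" "t i \<noteq> 0" "t b \<noteq> 0"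
    using Cons.prems inj_onD[OF Cons.prems(2), of i b] by auto
  show ?case
  proof (cases p)
    case 0
    then show ?thesis by (simp add: insert_at_def)
  next
    case (Suc p')
    have IH: "chain_weight t (insert_at p' i R) =
      chain_weight t R * (1 / (t i - (if p' < length R then t (R ! p') else 0)) -
         (if p' = 0 then 0 else 1 / (t i - (if p' - 1 < length R then t (R ! (p' - 1)) else 0))))"
      using Cons.prems Suc by (intro Cons.IH) (auto simp: inj_on_def)
    show ?thesis
    proof (cases R)
      case Nil
      then show ?thesis using Suc ib Cons.prems by (simp add: insert_at_def field_simps)
    next
      case R: (Cons r R')
      have r: "t b \<noteq> t r" "t i \<noteq> t r"
        using Cons.prems R inj_onD[OF Cons.prems(2), of b r] inj_onD[OF Cons.prems(2), of i r] by auto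
      show ?thesis
      \<comment> \<open>If \<open>i\<close> lands directly behind \<open>b\<close>, the partial
        fraction applies; otherwise the factor for the pair \<open>b\<close>, \<open>r\<close> is
        unchanged and the induction hypothesis suffices.\<close>
      proof (cases p')
        case 0
        have "1 / ((t b - t i) * (t i - t r)) = 1 / (t b - t r) * (1 / (t i - t r) - 1 / (t i - t b))"
          using r ib by (simp add: divide_simps) (simp add: algebra_simps)
        then have "chain_weight t R * (1 / ((t b - t i) * (t i - t r)))
            = chain_weight t R * (1 / (t b - t r) * (1 / (t i - t r) - 1 / (t i - t b)))"
          by (rule arg_cong)
        then show ?thesis
          using 0 Suc R by (simp add: insert_at_def mult_ac)
      next
        case (Suc p'')
        then show ?thesis
          using \<open>p = Suc p'\<close> IH R by (simp add: insert_at_def)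
      qed
    qed
  qed
qed

text \<open>Summation by parts, with the value of \<open>g\<close> before index 0 read as 0.\<close>

lemma abel_summation:
  fixes g w :: "nat \<Rightarrow> 'a::comm_ring"
  shows "(\<Sum>p\<le>m. (g p - (if p = 0 then 0 else g (p - 1))) * w p)
    = g m * w m + (\<Sum>p<m. g p * (w p - w (Suc p)))"
  by (induction m) (simp_all add: algebra_simps)

text \<open>The sum over all insertions of \<open>i\<close> telescopes: only the end of the word, where the weight is
  \<open>l\<close>, and the letters \<open>j\<close> at which the second factor jumps contribute.\<close>

lemma sum_insert_at:
  assumes "distinct (i # J)" "inj_on t (set (i # J))" "0 \<notin> t ` set (i # J)"
  shows "(\<Sum>p\<le>length J. chain_weight t (insert_at p i J) * (l - (\<Sum>j\<leftarrow>drop p J. c j)))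
    = chain_weight t J * (l / t i - (\<Sum>j\<in>set J. c j / (t i - t j)))"
proof -
  define g where "g p = 1 / (t i - (if p < length J then t (J ! p) else 0))" for p
  define w where "w p = l - (\<Sum>j\<leftarrow>drop p J. c j)" for p
  have "(\<Sum>p\<le>length J. chain_weight t (insert_at p i J) * w p)
      = chain_weight t J * (\<Sum>p\<le>length J. (g p - (if p = 0 then 0 else g (p - 1))) * w p)"
    unfolding sum_distrib_left g_def using assms
    by (intro sum.cong refl) (simp add: chain_weight_insert_at mult_ac)
  also have "(\<Sum>p\<le>length J. (g p - (if p = 0 then 0 else g (p - 1))) * w p)
      = l / t i + (\<Sum>p<length J. g p * (w p - w (Suc p)))"
    by (simp add: abel_summation) (simp add: g_def w_def)
  also have "(\<Sum>p<length J. g p * (w p - w (Suc p))) = (\<Sum>p<length J. - (c (J ! p) / (t i - t (J ! p))))"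
    by (intro sum.cong refl) (auto simp: g_def w_def simp flip: Cons_nth_drop_Suc)
  also have "\<dots> = (\<Sum>j\<in>set J. - (c j / (t i - t j)))"
    using assms(1) by (intro sum.reindex_bij_betw bij_betw_nth) auto
  finally show ?thesis by (simp add: w_def sum_negf)
qed

text \<open>An ordering of \<open>S\<close> amounts to an ordering of \<open>S - {i}\<close> and a
  position for \<open>i\<close>. The inverse map removes \<open>i\<close> and counts the letters in
  front of it.\<close>

lemma sum_permutations_of_set_remove:
  assumes "finite S" "i \<in> S"
  shows "(\<Sum>I\<in>permutations_of_set S. g I)
    = (\<Sum>J\<in>permutations_of_set (S - {i}). \<Sum>p\<le>length J. g (insert_at p i J))"
proof -
  have pos: "length (takeWhile (\<lambda>x. x \<noteq> i) (insert_at p i J)) = p"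
    if "i \<notin> set J" "p \<le> length J" for p J
  proof -
    have "takeWhile (\<lambda>x. x \<noteq> i) (take p J @ i # drop p J) = take p J"
      using that by (subst takeWhile_append2) (auto dest: in_set_takeD)
    then show ?thesis using that by (simp add: insert_at_def)
  qed
  have rem: "remove1 i (insert_at p i J) = J" if "i \<notin> set J" for p J
    using that by (auto simp: insert_at_def remove1_append dest: in_set_takeD)
  have ins: "insert_at (length (takeWhile (\<lambda>x. x \<noteq> i) I)) i (remove1 i I) = I" if "i \<in> set I" for I
    using that by (induction I) (auto simp: insert_at_def)
  have less: "length (takeWhile (\<lambda>x. x \<noteq> i) I) < length I" if "i \<in> set I" for I
    using that by (induction I) auto
  have "(\<Sum>J\<in>permutations_of_set (S - {i}). \<Sum>p\<le>length J. g (insert_at p i J))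
      = (\<Sum>(J, p)\<in>(SIGMA J:permutations_of_set (S - {i}). {..length J}). g (insert_at p i J))"
    by (rule sum.Sigma) auto
  also have "\<dots> = (\<Sum>I\<in>permutations_of_set S. g I)"
  proof (rule sum.reindex_bij_witness[where
        i = "\<lambda>I. (remove1 i I, length (takeWhile (\<lambda>x. x \<noteq> i) I))" and j = "\<lambda>(J, p). insert_at p i J"])
    fix x assume "x \<in> (SIGMA J:permutations_of_set (S - {i}). {..length J})"
    then obtain J p where x: "x = (J, p)" "set J = S - {i}" "distinct J" "p \<le> length J"
      by (cases x) (auto dest: permutations_of_setD)
    then have i: "i \<notin> set J" by blast
    show "(remove1 i (case x of (J, p) \<Rightarrow> insert_at p i J),
        length (takeWhile (\<lambda>x. x \<noteq> i) (case x of (J, p) \<Rightarrow> insert_at p i J))) = x"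
      unfolding x(1) prod.case rem[OF i] pos[OF i x(4)] ..
    have "set (insert_at p i J) = S" "distinct (insert_at p i J)"
      using x(2,3) i assms(2) by (simp_all only: set_insert_at distinct_insert_at) auto
    with x(1) show "(case x of (J, p) \<Rightarrow> insert_at p i J) \<in> permutations_of_set S"
      by (simp add: permutations_of_set_def)
  next
    fix I assume "I \<in> permutations_of_set S"
    then have I: "set I = S" "distinct I" by (auto simp: permutations_of_set_def)
    then show "(case (remove1 i I, length (takeWhile (\<lambda>x. x \<noteq> i) I)) of (J, p) \<Rightarrow> insert_at p i J) = I"
      using assms by (simp add: ins)
    have "length (takeWhile (\<lambda>x. x \<noteq> i) I) < length I"
      using I(1) assms(2) by (intro less) simp
    moreover have "length (remove1 i I) = length I - 1"
      using I(1) assms(2) by (simp add: length_remove1)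
    moreover have "remove1 i I \<in> permutations_of_set (S - {i})"
      using I by (simp add: permutations_of_set_def)
    ultimately show "(remove1 i I, length (takeWhile (\<lambda>x. x \<noteq> i) I))
        \<in> (SIGMA J:permutations_of_set (S - {i}). {..length J})"
      by simp
  qed auto
  finally show ?thesis by simp
qed

section \<open>The critical point and the Hessian\<close>

text \<open>Here \<open>a i\<close> is the denominator lambda_i + ... + lambda_n + n - i + 1 of the
  i-th factor of the critical point, and \<open>a i - 1\<close> its numerator. The values
  \<open>t 0 = 1\<close> and \<open>a (Suc n) = 0\<close> bring the first and the last index under
  the general formulas.\<close>

locale critical =
  fixes n :: nat and l t a :: "nat \<Rightarrow> complex"
  assumes l_eq: "i \<in> {1..n} \<Longrightarrow> l i = a i - a (Suc i) - 1"
    and a_end: "a (Suc n) = 0"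
    and a_nz: "i \<in> {1..n} \<Longrightarrow> a i \<noteq> 0"
    and t_0: "t 0 = 1"
    and t_Suc: "i < n \<Longrightarrow> t (Suc i) = t i * ((a (Suc i) - 1) / a (Suc i))"
    and t_nz: "i \<le> n \<Longrightarrow> t i \<noteq> 0"
begin

lemma a_neq_1: "i \<in> {1..n} \<Longrightarrow> a i \<noteq> 1"
  using t_Suc[of "i - 1"] t_nz[of i] by (cases i) auto

text \<open>The first form at \<open>i\<close> and the second at \<open>Suc i\<close> express the
  differences to both neighbours through \<open>t i\<close>, which gives all terms at index
  \<open>i\<close> a common denominator.\<close>

lemma t_diff:
  assumes "i \<in> {1..n}"
  shows "t i - t (i - 1) = - t i / (a i - 1)" "t i - t (i - 1) = - t (i - 1) / a i"
proof -
  have "t i = t (i - 1) * ((a i - 1) / a i)"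
    using t_Suc[of "i - 1"] assms by (cases i) simp_all
  then show "t i - t (i - 1) = - t i / (a i - 1)" "t i - t (i - 1) = - t (i - 1) / a i"
    using a_nz[OF assms] a_neq_1[OF assms] by (simp_all add: field_simps)
qed

lemma t_diff_nz: "i \<in> {1..n} \<Longrightarrow> t i \<noteq> t (i - 1)"
  using t_diff(1)[of i] t_nz[of i] a_neq_1[of i] by auto

text \<open>The vanishing of the partial derivative of ln Phi in t_i, with reversed sign. Multiplied
  by \<open>t i\<close> it reads \<open>l i - (a i - 1) + a (Suc i) = 0\<close>.\<close>

lemma critical_eq:
  assumes "i \<in> {1..n}"
  shows "l i / t i + 1 / (t i - t (i - 1)) + (if i < n then 1 / (t i - t (Suc i)) else 0) = 0"
proof -
  have 1: "1 / (t i - t (i - 1)) = - (a i - 1) / t i"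
    using t_diff(1)[OF assms] by (simp add: diff_divide_distrib)
  have 2: "(if i < n then 1 / (t i - t (Suc i)) else 0) = a (Suc i) / t i"
  proof (cases "i < n")
    case True
    then have "t i - t (Suc i) = t i / a (Suc i)"
      using t_diff(2)[of "Suc i"] by (simp add: algebra_simps)
    then show ?thesis using True by simp
  next
    case False
    then show ?thesis using assms a_end by auto
  qed
  show ?thesis
    unfolding 1 2 l_eq[OF assms] by (simp add: diff_divide_distrib add_divide_distrib)
qed

section \<open>Triangular factorization of the Hessian at the critical point\<close>

definition hess :: "complex mat" where
  "hess = Matrix.mat n n (\<lambda>(i, j).
     if i = j then l (Suc i) / (t (Suc i))\<^sup>2 + 1 / (t (Suc i) - t i)\<^sup>2
       + (if Suc i < n then 1 / (t (Suc (Suc i)) - t (Suc i))\<^sup>2 else 0)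
     else if j = Suc i then - 1 / (t (Suc j) - t j)\<^sup>2
     else if i = Suc j then - 1 / (t (Suc i) - t i)\<^sup>2
     else 0)"

text \<open>Elimination starts from the last row, hence a unit upper triangular factor. Row
  \<open>i\<close> belongs to \<open>t (Suc i)\<close>, and the entry in column
  \<open>j = Suc i\<close> is \<open>- t (Suc j) / t j\<close>.\<close>

definition elim :: "complex mat" where
  "elim = Matrix.mat n n (\<lambda>(i, j).
     if i = j then 1 else if j = Suc i then - ((a (Suc j) - 1) / a (Suc j)) else 0)"

definition pivot :: "nat \<Rightarrow> complex" where
  "pivot i = a (Suc i) * (a (Suc i) - 1) / (t (Suc i))\<^sup>2"

text \<open>The first identity gives the off-diagonal entries up to sign, the second what the
  following pivot contributes to a diagonal entry.\<close>

lemma pivot_ratio: "Suc i < n \<Longrightarrow> pivot (Suc i) * ((a (Suc (Suc i)) - 1) / a (Suc (Suc i)))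
    = 1 / (t (Suc (Suc i)) - t (Suc i))\<^sup>2"
  "Suc i < n \<Longrightarrow> pivot (Suc i) * ((a (Suc (Suc i)) - 1) / a (Suc (Suc i)))\<^sup>2
    = a (Suc (Suc i)) * (a (Suc (Suc i)) - 1) / (t (Suc i))\<^sup>2"
proof -
  assume i: "Suc i < n"
  then have nz: "a (Suc (Suc i)) \<noteq> 0" "a (Suc (Suc i)) \<noteq> 1" "t (Suc i) \<noteq> 0" "t (Suc (Suc i)) \<noteq> 0"
    using a_nz a_neq_1 t_nz by auto
  have "t (Suc (Suc i)) - t (Suc i) = - t (Suc (Suc i)) / (a (Suc (Suc i)) - 1)"
    using t_diff(1)[of "Suc (Suc i)"] i by simp
  then show "pivot (Suc i) * ((a (Suc (Suc i)) - 1) / a (Suc (Suc i))) = 1 / (t (Suc (Suc i)) - t (Suc i))\<^sup>2"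
    unfolding pivot_def using nz by (simp only:) (simp add: power2_eq_square)
  have "t (Suc (Suc i)) = t (Suc i) * ((a (Suc (Suc i)) - 1) / a (Suc (Suc i)))"
    using t_Suc i by blast
  then show "pivot (Suc i) * ((a (Suc (Suc i)) - 1) / a (Suc (Suc i)))\<^sup>2
    = a (Suc (Suc i)) * (a (Suc (Suc i)) - 1) / (t (Suc i))\<^sup>2"
    unfolding pivot_def using nz by (simp add: power2_eq_square)
qed

text \<open>Over the common denominator t_{i+1}^2, with a = a_{i+1} and b = a_{i+2}, this is (a - b
  - 1) + (a - 1)^2 + b^2 = a(a - 1) + b(b - 1).\<close>

lemma hess_diag: "i < n \<Longrightarrow> hess $$ (i, i)
    = pivot i + (if Suc i < n then pivot (Suc i) * ((a (Suc (Suc i)) - 1) / a (Suc (Suc i)))\<^sup>2 else 0)"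
proof -
  assume i: "i < n"
  have 1: "1 / (t (Suc i) - t i)\<^sup>2 = (a (Suc i) - 1)\<^sup>2 / (t (Suc i))\<^sup>2"
    using t_diff(1)[of "Suc i"] i by (simp add: power_divide)
  \<comment> \<open>In the last row there is no right neighbour, and \<open>a (Suc n) = 0\<close>
    makes the right side vanish as well.\<close>
  have 2: "(if Suc i < n then 1 / (t (Suc (Suc i)) - t (Suc i))\<^sup>2 else 0) = (a (Suc (Suc i)))\<^sup>2 / (t (Suc i))\<^sup>2"
  proof (cases "Suc i < n")
    case True
    then show ?thesis
      using t_diff(2)[of "Suc (Suc i)"] by (simp add: power_divide)
  next
    case False
    with i have "Suc i = n" by simp
    then show ?thesis using a_end by simp
  qed
  have 3: "(if Suc i < n then pivot (Suc i) * ((a (Suc (Suc i)) - 1) / a (Suc (Suc i)))\<^sup>2 else 0)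
      = a (Suc (Suc i)) * (a (Suc (Suc i)) - 1) / (t (Suc i))\<^sup>2"
  proof (cases "Suc i < n")
    case False
    with i have "Suc i = n" by simp
    then show ?thesis using a_end by simp
  qed (simp add: pivot_ratio(2))
  have "hess $$ (i, i) = l (Suc i) / (t (Suc i))\<^sup>2 + 1 / (t (Suc i) - t i)\<^sup>2
       + (if Suc i < n then 1 / (t (Suc (Suc i)) - t (Suc i))\<^sup>2 else 0)"
    using i by (simp add: hess_def)
  also have "\<dots> = pivot i + a (Suc (Suc i)) * (a (Suc (Suc i)) - 1) / (t (Suc i))\<^sup>2"
    unfolding 1 2 using l_eq[of "Suc i"] i
    by (simp add: pivot_def flip: add_divide_distrib) (simp add: power2_eq_square algebra_simps)
  finally show ?thesis unfolding 3 .
qed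

lemma hess_factor:
  "hess = elim * (Matrix.mat n n (\<lambda>(i, j). if i = j then pivot i else 0) * transpose_mat elim)"
    (is "_ = elim * (?D * _)")
proof (rule eq_matI)
  fix i j assume ij: "i < dim_row (elim * (?D * transpose_mat elim))"
    "j < dim_col (elim * (?D * transpose_mat elim))"
  then have i: "i < n" and j: "j < n" by (simp_all add: elim_def)
  have DU: "(?D * transpose_mat elim) $$ (k, j) = pivot k * elim $$ (j, k)" if "k < n" for k
  proof -
    have "(?D * transpose_mat elim) $$ (k, j) = (\<Sum>m<n. (if k = m then pivot k else 0) * elim $$ (j, m))"
      using that j by (simp add: scalar_prod_def elim_def atLeast0LessThan)
    also have "\<dots> = (\<Sum>m<n. if k = m then pivot k * elim $$ (j, m) else 0)"
      by (intro sum.cong) auto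
    also have "\<dots> = pivot k * elim $$ (j, k)" using that by simp
    finally show ?thesis .
  qed
  have "(elim * (?D * transpose_mat elim)) $$ (i, j) = (\<Sum>k<n. elim $$ (i, k) * (?D * transpose_mat elim) $$ (k, j))"
    using i j by (simp add: scalar_prod_def elim_def atLeast0LessThan del: index_mult_mat(1)) (simp add: scalar_prod_def atLeast0LessThan)
  also have "\<dots> = (\<Sum>k<n. elim $$ (i, k) * (pivot k * elim $$ (j, k)))"
    by (intro sum.cong refl) (simp only: DU lessThan_iff)
  \<comment> \<open>Row \<open>i\<close> of \<open>elim\<close> is supported on these two columns;
    the second one is missing in the last row.\<close>
  also have "\<dots> = (\<Sum>k\<in>{i, Suc i} \<inter> {..<n}. elim $$ (i, k) * (pivot k * elim $$ (j, k)))"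
    using i by (intro sum.mono_neutral_right) (auto simp: elim_def)
  also have "\<dots> = elim $$ (i, i) * (pivot i * elim $$ (j, i))
      + (if Suc i < n then elim $$ (i, Suc i) * (pivot (Suc i) * elim $$ (j, Suc i)) else 0)"
    using i by (auto simp: Int_insert_left)
  also have "\<dots> = hess $$ (i, j)"
  proof -
    consider "j = i" | "j = Suc i" | "i = Suc j" | "j \<noteq> i" "j \<noteq> Suc i" "i \<noteq> Suc j" by blast
    then show ?thesis
    proof cases
      case 1
      then show ?thesis using i by (simp only: hess_diag) (simp add: elim_def power2_eq_square)
    next
      case 2
      then show ?thesis using i j pivot_ratio(1)[of i] by (simp add: elim_def hess_def mult.commute)
    next
      case 3
      then show ?thesis using i j pivot_ratio(1)[of j] by (simp add: elim_def hess_def mult.commute)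
    next
      case 4
      then show ?thesis using i j by (simp add: elim_def hess_def)
    qed
  qed
  finally show "hess $$ (i, j) = (elim * (?D * transpose_mat elim)) $$ (i, j)" by simp
qed (simp_all add: hess_def elim_def)

lemma det_elim: "Determinant.det elim = 1"
  by (subst det_upper_triangular[of _ n])
    (auto simp: upper_triangular_def elim_def diag_mat_def prod.distinct_set_conv_list[symmetric]
      intro!: prod.neutral)

lemma det_hess: "Determinant.det hess = (\<Prod>i<n. pivot i)"
proof -
  have "Determinant.det (Matrix.mat n n (\<lambda>(i, j). if i = j then pivot i else 0)) = (\<Prod>i<n. pivot i)"
    by (subst det_upper_triangular[of _ n])
      (auto simp: upper_triangular_def diag_mat_def prod.distinct_set_conv_list[symmetric] atLeast0LessThan
        intro!: prod.cong)
  moreover have "elim \<in> carrier_mat n n" by (simp add: elim_def)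
  ultimately show ?thesis
    by (subst hess_factor) (simp add: det_mult[of _ n] det_transpose[of _ n] det_elim mult_carrier_mat[of _ n n])
qed

text \<open>The formula holds for all partial products of pivots: it starts from
  \<open>t 0 = 1\<close>, and \<open>pivot m / t m\<close> supplies the next squared difference
  together with the new denominator \<open>t (Suc m)\<close>.\<close>

lemma det_hess_eq: "Determinant.det hess = (\<Prod>s\<in>{1..n}. 1 / (t s - t (s - 1)))\<^sup>2 / t n"
proof -
  have "(\<Prod>i<m. pivot i) = (\<Prod>s\<in>{1..m}. 1 / (t s - t (s - 1)))\<^sup>2 / t m" if "m \<le> n" for m
    using that
  proof (induction m)
    case (Suc m)
    then have nz: "a (Suc m) \<noteq> 0" "a (Suc m) \<noteq> 1" "t m \<noteq> 0" "t (Suc m) \<noteq> 0"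
      using a_nz a_neq_1 t_nz by auto
    have d: "t (Suc m) - t m = - t (Suc m) / (a (Suc m) - 1)"
      using t_diff(1)[of "Suc m"] Suc.prems by simp
    have t: "t m = t (Suc m) * (a (Suc m) / (a (Suc m) - 1))"
      using t_Suc[of m] Suc.prems nz by simp
    have "pivot m / t m = (1 / (t (Suc m) - t m))\<^sup>2 / t (Suc m)"
      unfolding d unfolding pivot_def t using nz by (simp add: power2_eq_square)
    then show ?case
      using Suc by (simp add: power_mult_distrib power_divide flip: times_divide_eq_right)
  qed (simp add: t_0)
  then show ?thesis unfolding det_hess by simp
qed

end

section \<open>Logarithm branches and the second derivatives\<close>

lemma log_branch_at_nonzero: "log_branch_at p L \<Longrightarrow> p \<noteq> 0"
  unfolding log_branch_at_def by (metis exp_not_eq_zero)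

text \<open>A continuous right inverse of \<open>exp\<close> is differentiable by the inverse
  function rule. A whole neighbourhood is required because the derivative will be differentiated
  again.\<close>

lemma eventually_log_branch_deriv:
  assumes "log_branch_at p L"
  shows "eventually (\<lambda>z. (L has_field_derivative inverse z) (at z)) (nhds p)"
proof -
  obtain U where U: "open U" "p \<in> U" "continuous_on U L" "\<And>z. z \<in> U \<Longrightarrow> exp (L z) = z"
    using assms by (auto simp: log_branch_at_def)
  have "(L has_field_derivative inverse z) (at z)" if z: "z \<in> U" for z
  proof (rule has_field_derivative_inverse_basic[where f = exp and t = U])
    show "DERIV exp (L z) :> z"
      using DERIV_exp[of "L z"] U(4)[OF z] by simp
    show "z \<noteq> 0" using U(4)[OF z] exp_not_eq_zero by metis
    show "continuous (at z) L"
      using U z by (simp add: continuous_on_eq_continuous_at)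
  qed (use U z in auto)
  then show ?thesis
    using U by (auto simp: eventually_nhds)
qed

lemma eventually_nhds_compose_isCont:
  fixes g :: "complex \<Rightarrow> complex"
  assumes "eventually P (nhds (g w))" "isCont g w"
  shows "eventually (\<lambda>z. P (g z)) (nhds w)"
proof (rule eventually_compose_filterlim[OF assms(1)])
  show "filterlim g (nhds (g w)) (nhds w)"
    using assms(2) unfolding isCont_def tendsto_at_iff_tendsto_nhds .
qed

lemma sum_if_two:
  fixes F :: "nat \<Rightarrow> 'a::comm_monoid_add"
  assumes "finite S" "a \<noteq> b"
  shows "(\<Sum>i\<in>S. if i = a then x else if i = b then y else 0)
    = (if a \<in> S then x else 0) + (if b \<in> S then y else 0)"
proof -
  have "(\<Sum>i\<in>S. if i = a then x else if i = b then y else 0)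
    = (\<Sum>i\<in>S. (if i = a then x else 0) + (if i = b then y else 0))"
    using assms(2) by (intro sum.cong) auto
  then show ?thesis using assms(1) by (simp add: sum.distrib)
qed

locale log_branches =
  fixes n :: nat and l t :: "nat \<Rightarrow> complex" and L M :: "nat \<Rightarrow> complex \<Rightarrow> complex"
  assumes L: "j \<in> {1..n} \<Longrightarrow> log_branch_at (t j) (L j)"
    and M_1: "log_branch_at (1 - t 1) (M 1)"
    and M: "j \<in> {2..n} \<Longrightarrow> log_branch_at (t j - t (j - 1)) (M j)"
begin

text \<open>The points at which differentiating \<open>ln_phase\<close> term by term yields
  \<open>grad\<close>.\<close>

definition good :: "(nat \<Rightarrow> complex) \<Rightarrow> bool" where
  "good u \<longleftrightarrow> (\<forall>j\<in>{1..n}. (L j has_field_derivative inverse (u j)) (at (u j))) \<and>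
    (M 1 has_field_derivative inverse (1 - u 1)) (at (1 - u 1)) \<and>
    (\<forall>j\<in>{2..n}. (M j has_field_derivative inverse (u j - u (j - 1))) (at (u j - u (j - 1))))"

text \<open>The case \<open>j = 1\<close> is the general one with \<open>u 0\<close> read as 1; it
  is separate because \<open>u 0\<close> is arbitrary here.\<close>

definition grad :: "nat \<Rightarrow> (nat \<Rightarrow> complex) \<Rightarrow> complex" where
  "grad j u = (if j = 1 then inverse (1 - u 1) else - inverse (u j - u (j - 1))) - l j * inverse (u j)
    + (if j < n then inverse (u (Suc j) - u j) else 0)"

lemma partial_deriv_ln_phase:
  assumes "good u" "j \<in> {1..n}"
  shows "partial_deriv j (ln_phase n l 1 L M) u = grad j u"
proof -
  have dL: "((\<lambda>z. L k ((u(j := z)) k)) has_field_derivative (if k = j then inverse (u j) else 0)) (at (u j))"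
    if "k \<in> {1..n}" for k
    using assms that by (auto simp: good_def)
  have dM1: "((\<lambda>z. M 1 (1 - (u(j := z)) 1)) has_field_derivative (if j = 1 then - inverse (1 - u 1) else 0)) (at (u j))"
  proof (cases "j = 1")
    case True
    have "((\<lambda>z. M 1 (1 - z)) has_field_derivative inverse (1 - u 1) * (0 - 1)) (at (u 1))"
      using assms by (intro DERIV_chain2[where f = "M 1"] derivative_intros) (auto simp: good_def)
    then show ?thesis using True by simp
  qed simp
  \<comment> \<open>The variable with index \<open>j\<close> enters the difference number
    \<open>j\<close> with sign plus and number \<open>j + 1\<close> with sign minus.\<close>
  have dM: "((\<lambda>z. M k ((u(j := z)) k - (u(j := z)) (k - 1))) has_field_derivative
      (if k = j then inverse (u j - u (j - 1)) else if k = Suc j then - inverse (u (Suc j) - u j) else 0)) (at (u j))"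
    if k: "k \<in> {2..n}" for k
  proof -
    have m: "(M k has_field_derivative inverse (u k - u (k - 1))) (at (u k - u (k - 1)))"
      using assms k by (auto simp: good_def)
    consider "k = j" | "k = Suc j" | "k \<noteq> j" "k \<noteq> Suc j" by blast
    then show ?thesis
    proof cases
      case 1
      have "((\<lambda>z. M j (z - u (j - 1))) has_field_derivative inverse (u j - u (j - 1)) * (1 - 0)) (at (u j))"
        using m 1 by (intro DERIV_chain2[where f = "M j"] derivative_intros) auto
      \<comment> \<open>Truncated subtraction is harmless since \<open>k\<close> is at least 2;
        hence the update at \<open>j\<close> does not touch index \<open>j - 1\<close>.\<close>
      moreover have "j - 1 \<noteq> j" using 1 k by auto
      ultimately show ?thesis using 1 by simp
    next
      case 2
      have "((\<lambda>z. M k (u k - z)) has_field_derivative inverse (u k - u j) * (0 - 1)) (at (u j))"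
        using m 2 by (intro DERIV_chain2[where f = "M k"] derivative_intros) auto
      then show ?thesis using 2 by simp
    next
      case 3
      then have "k - 1 \<noteq> j" using k by auto
      then show ?thesis using 3 by simp
    qed
  qed
  have "((\<lambda>z. ln_phase n l 1 L M (u(j := z))) has_field_derivative
      (- 1) * (if j = 1 then - inverse (1 - u 1) else 0)
      - (\<Sum>k\<in>{1..n}. l k * (if k = j then inverse (u j) else 0))
      - (\<Sum>k\<in>{2..n}. if k = j then inverse (u j - u (j - 1)) else if k = Suc j then - inverse (u (Suc j) - u j) else 0))
      (at (u j))"
    unfolding ln_phase_def div_by_1 mult_1
    by (intro DERIV_diff DERIV_sum DERIV_cmult dM1 dL dM)
  then have "partial_deriv j (ln_phase n l 1 L M) u =
      (- 1) * (if j = 1 then - inverse (1 - u 1) else 0)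
      - (\<Sum>k\<in>{1..n}. l k * (if k = j then inverse (u j) else 0))
      - (\<Sum>k\<in>{2..n}. if k = j then inverse (u j - u (j - 1)) else if k = Suc j then - inverse (u (Suc j) - u j) else 0)"
    unfolding partial_deriv_def by (rule DERIV_imp_deriv)
  also have "(\<Sum>k\<in>{1..n}. l k * (if k = j then inverse (u j) else 0)) = l j * inverse (u j)"
    using assms(2) by (simp add: if_distrib[of "\<lambda>x. _ * x"] cong: if_cong)
  also have "(\<Sum>k\<in>{2..n}. if k = j then inverse (u j - u (j - 1)) else if k = Suc j then - inverse (u (Suc j) - u j) else 0)
      = (if j = 1 then 0 else inverse (u j - u (j - 1))) + (if j < n then - inverse (u (Suc j) - u j) else 0)"
    using assms(2) by (subst sum_if_two) auto
  finally show ?thesis by (simp add: grad_def)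
qed

lemma eventually_good:
  assumes i: "i \<in> {1..n}"
  shows "eventually (\<lambda>z. good (t(i := z))) (nhds (t i))"
proof -
  have upd: "isCont (\<lambda>z. (t(i := z)) k) (t i)" for k
    by (cases "k = i") auto
  have L': "eventually (\<lambda>z. (L j has_field_derivative inverse ((t(i := z)) j)) (at ((t(i := z)) j))) (nhds (t i))"
    if "j \<in> {1..n}" for j
    using eventually_log_branch_deriv[OF L[OF that]] upd
    by (intro eventually_nhds_compose_isCont[where g = "\<lambda>z. (t(i := z)) j"]) simp_all
  have M1': "eventually (\<lambda>z. (M 1 has_field_derivative inverse (1 - (t(i := z)) 1)) (at (1 - (t(i := z)) 1))) (nhds (t i))"
    using eventually_log_branch_deriv[OF M_1] upd
    by (intro eventually_nhds_compose_isCont[where g = "\<lambda>z. 1 - (t(i := z)) 1"] continuous_intros) simp_all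
  have M': "eventually (\<lambda>z. (M j has_field_derivative inverse ((t(i := z)) j - (t(i := z)) (j - 1)))
      (at ((t(i := z)) j - (t(i := z)) (j - 1)))) (nhds (t i))"
    if "j \<in> {2..n}" for j
    using eventually_log_branch_deriv[OF M[OF that]] upd
    by (intro eventually_nhds_compose_isCont[where g = "\<lambda>z. (t(i := z)) j - (t(i := z)) (j - 1)"] continuous_intros) simp_all
  show ?thesis
    unfolding good_def
    by (intro eventually_conj eventually_ball_finite ballI finite_atLeastAtMost L' M1' M')
qed

text \<open>A derivative depends only on the germ, so the first partial may be replaced by the
  rational function \<open>grad\<close>, with which it agrees near \<open>t\<close>.\<close>

lemma second_partial_deriv:
  assumes "i \<in> {1..n}" "j \<in> {1..n}" "((\<lambda>z. grad j (t(i := z))) has_field_derivative D) (at (t i))"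
  shows "partial_deriv i (partial_deriv j (ln_phase n l 1 L M)) t = D"
proof -
  have "eventually (\<lambda>z. partial_deriv j (ln_phase n l 1 L M) (t(i := z)) = grad j (t(i := z))) (nhds (t i))"
    using eventually_good[OF assms(1)] by eventually_elim (rule partial_deriv_ln_phase[OF _ assms(2)])
  then have "deriv (\<lambda>z. partial_deriv j (ln_phase n l 1 L M) (t(i := z))) (t i) = deriv (\<lambda>z. grad j (t(i := z))) (t i)"
    by (rule deriv_cong_ev) simp
  then show ?thesis
    using DERIV_imp_deriv[OF assms(3)] by (simp add: partial_deriv_def)
qed

lemma t_nonzero: "j \<in> {1..n} \<Longrightarrow> t j \<noteq> 0" "1 - t 1 \<noteq> 0" "j \<in> {2..n} \<Longrightarrow> t j - t (j - 1) \<noteq> 0"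
  using log_branch_at_nonzero L M_1 M by blast+

lemma second_partials:
  assumes "i \<in> {1..n}" "j \<in> {1..n}"
  shows "partial_deriv i (partial_deriv j (ln_phase n l 1 L M)) t =
    (if i = j then l j / (t j)\<^sup>2 + (if j = 1 then 1 / (1 - t 1)\<^sup>2 else 1 / (t j - t (j - 1))\<^sup>2)
       + (if j < n then 1 / (t (Suc j) - t j)\<^sup>2 else 0)
     else if i = Suc j then - 1 / (t i - t j)\<^sup>2
     else if j = Suc i then - 1 / (t j - t i)\<^sup>2
     else 0)" (is "_ = ?D")
proof (rule second_partial_deriv[OF assms])
  have nz: "t j \<noteq> 0" "1 - t 1 \<noteq> 0" "j \<noteq> 1 \<Longrightarrow> t j - t (j - 1) \<noteq> 0" "j < n \<Longrightarrow> t (Suc j) - t j \<noteq> 0"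
    using t_nonzero(1)[of j] t_nonzero(2) t_nonzero(3)[of j] t_nonzero(3)[of "Suc j"] assms by auto
  \<comment> \<open>The derivative of the coordinate \<open>k\<close> along the line in direction
    \<open>i\<close>; it treats all positions of \<open>i\<close> relative to \<open>j\<close> at
    once.\<close>
  define \<delta> :: "nat \<Rightarrow> complex" where "\<delta> k = (if k = i then 1 else 0)" for k
  have upd: "((\<lambda>z. (t(i := z)) k) has_field_derivative \<delta> k) (at (t i))" for k
    by (cases "k = i") (auto simp: \<delta>_def)
  have inv: "((\<lambda>z. inverse (g z)) has_field_derivative - d / (g (t i))\<^sup>2) (at (t i))"
    if "(g has_field_derivative d) (at (t i))" "g (t i) \<noteq> 0" for g d
    using DERIV_inverse_fun[OF that] by (simp add: power2_eq_square field_simps)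
  have "((\<lambda>z. grad j (t(i := z))) has_field_derivative
      (if j = 1 then - (0 - \<delta> 1) / (1 - t 1)\<^sup>2 else - (- (\<delta> j - \<delta> (j - 1)) / (t j - t (j - 1))\<^sup>2))
      - l j * (- \<delta> j / (t j)\<^sup>2)
      + (if j < n then - (\<delta> (Suc j) - \<delta> j) / (t (Suc j) - t j)\<^sup>2 else 0)) (at (t i))"
  proof -
    have 1: "((\<lambda>z. inverse (1 - (t(i := z)) 1)) has_field_derivative - (0 - \<delta> 1) / (1 - t 1)\<^sup>2) (at (t i))"
      using inv[OF DERIV_diff[OF DERIV_const upd[of 1]]] nz by simp
    have 2: "((\<lambda>z. - inverse ((t(i := z)) j - (t(i := z)) (j - 1))) has_field_derivative
        - (- (\<delta> j - \<delta> (j - 1)) / (t j - t (j - 1))\<^sup>2)) (at (t i))" if "j \<noteq> 1"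
      using inv[OF DERIV_diff[OF upd[of j] upd[of "j - 1"]]] nz that by (intro DERIV_minus) simp
    have 3: "((\<lambda>z. l j * inverse ((t(i := z)) j)) has_field_derivative l j * (- \<delta> j / (t j)\<^sup>2)) (at (t i))"
      using inv[OF upd[of j]] nz by (intro DERIV_cmult) simp
    have 4: "((\<lambda>z. inverse ((t(i := z)) (Suc j) - (t(i := z)) j)) has_field_derivative
        - (\<delta> (Suc j) - \<delta> j) / (t (Suc j) - t j)\<^sup>2) (at (t i))" if "j < n"
      using inv[OF DERIV_diff[OF upd[of "Suc j"] upd[of j]]] nz that by simp
    have 5: "((\<lambda>z. if j = 1 then inverse (1 - (t(i := z)) 1) else - inverse ((t(i := z)) j - (t(i := z)) (j - 1)))
        has_field_derivative
        (if j = 1 then - (0 - \<delta> 1) / (1 - t 1)\<^sup>2 else - (- (\<delta> j - \<delta> (j - 1)) / (t j - t (j - 1))\<^sup>2))) (at (t i))"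
      using 1 2 by (cases "j = 1") simp_all
    have 6: "((\<lambda>z. if j < n then inverse ((t(i := z)) (Suc j) - (t(i := z)) j) else 0) has_field_derivative
        (if j < n then - (\<delta> (Suc j) - \<delta> j) / (t (Suc j) - t j)\<^sup>2 else 0)) (at (t i))"
      using 4 by (cases "j < n") simp_all
    show ?thesis unfolding grad_def by (intro DERIV_add DERIV_diff 3 5 6)
  qed
  also have "(if j = 1 then - (0 - \<delta> 1) / (1 - t 1)\<^sup>2 else - (- (\<delta> j - \<delta> (j - 1)) / (t j - t (j - 1))\<^sup>2))
      - l j * (- \<delta> j / (t j)\<^sup>2)
      + (if j < n then - (\<delta> (Suc j) - \<delta> j) / (t (Suc j) - t j)\<^sup>2 else 0) = ?D"
    using assms by (auto simp: \<delta>_def)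
  finally show "((\<lambda>z. grad j (t(i := z))) has_field_derivative ?D) (at (t i))" .
qed

end

section \<open>Verma and irreducible modules as highest weight representations\<close>

lemma module_nc_scale: "Modules.module nc_scale"
proof
  have lk: "Poly_Mapping.lookup (nc_scale c p) w = c * Poly_Mapping.lookup p w" for c p w
    by (simp add: nc_scale_def Poly_Mapping.map.rep_eq when_def)
  show "nc_scale a (x + y) = nc_scale a x + nc_scale a y" for a x y
    by (rule poly_mapping_eqI) (simp add: lk lookup_add algebra_simps)
  show "nc_scale (a + b) x = nc_scale a x + nc_scale b x" for a b x
    by (rule poly_mapping_eqI) (simp add: lk lookup_add algebra_simps)
  show "nc_scale a (nc_scale b x) = nc_scale (a * b) x" for a b x
    by (rule poly_mapping_eqI) (simp add: lk)
  show "nc_scale 1 x = x" for x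
    by (rule poly_mapping_eqI) (simp add: lk)
qed

lemma nc_scale_word: "nc_scale c (word w) = Poly_Mapping.single w c"
  by (rule poly_mapping_eqI) (simp add: nc_scale_def Poly_Mapping.map.rep_eq lookup_single when_def)

lemma nc_eval_word:
  assumes "vector_space sc"
  shows "nc_eval sc act v (word w) = foldr act w v"
proof -
  interpret vector_space sc by fact
  show ?thesis by (simp add: nc_eval_def)
qed

lemma nc_eval_word_diff:
  assumes "vector_space sc" "w \<noteq> w'"
  shows "nc_eval sc act v (word w - nc_scale c (word w')) = foldr act w v - sc c (foldr act w' v)"
proof -
  interpret vector_space sc by fact
  let ?p = "word w - nc_scale c (word w')"
  \<comment> \<open>The support may be smaller than this pair, as \<open>c\<close> can be 0; the
    added summand is then 0.\<close>
  have "nc_eval sc act v ?p = (\<Sum>u\<in>{w, w'}. sc (Poly_Mapping.lookup ?p u) (foldr act u v))"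
    unfolding nc_eval_def
    by (intro sum.mono_neutral_left)
      (auto simp: in_keys_iff nc_scale_word lookup_minus lookup_single when_def split: if_splits)
  then show ?thesis
    using assms(2) by (simp add: nc_scale_word lookup_minus lookup_single)
qed

text \<open>The relations with empty prefix lie in the kernel of evaluation at \<open>v\<close>, and
  their evaluations are the two conditions on \<open>v\<close>.\<close>

lemma verma_highest_weight_rep:
  assumes "verma_module n lam sc act v"
  shows "highest_weight_rep n lam sc act v"
proof
  have rep: "sl_rep n sc act" and
    ker: "\<And>p. p \<in> env_relations n \<union> hw_relations n lam \<Longrightarrow> nc_eval sc act v p = 0"
    using assms module.span_base[OF module_nc_scale] unfolding verma_module_def by blast+
  then have vs: "vector_space sc" by (simp add: sl_rep_def)
  interpret vector_space sc by fact
  show "sl_rep n sc act" by fact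
  show "act x v = 0" if "x \<in> nilp_pos n" for x
  proof -
    have "word ([] @ [x]) \<in> hw_relations n lam"
      unfolding hw_relations_def using that by blast
    then show ?thesis using ker nc_eval_word[OF vs, of act v "[x]"] by auto
  qed
  show "act h v = sc (lam h) v" if "h \<in> cartan n" for h
  proof -
    have "word ([] @ [h]) - nc_scale (lam h) (word []) \<in> hw_relations n lam"
      unfolding hw_relations_def using that by blast
    then show ?thesis using ker nc_eval_word_diff[OF vs, of "[h]" "[]" act v "lam h"] by auto
  qed
qed

lemma irreducible_highest_weight_rep:
  "irreducible_hw_rep n lam sc act v \<Longrightarrow> highest_weight_rep n lam sc act v"
  by unfold_locales (auto simp: irreducible_hw_rep_def irreducible_rep_def highest_weight_vector_def)

section \<open>Norm of the Bethe vector\<close>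

context highest_weight_rep
begin

text \<open>Different indices give words of different length. For equal ones, e_{k+1} removes the
  leading letter with coefficient 1: for k = 0 this is the weight, for k > 0 it comes from the
  letter k.\<close>

lemma linear_rep_orthonormal:
  assumes B: "shapovalov_form n sc act v B"
    and wt: "\<forall>i\<in>{1..n}. wt_coord n lam i = (if i = 1 then 1 else 0)"
    and "j \<le> n" "k \<le> n"
  shows "B (F (rev [1..<j + 1])) (F (rev [1..<k + 1])) = (if j = k then 1 else 0)"
proof (cases "j = k")
  case False
  then show ?thesis
    using assms by (subst form_F_length[OF B]) auto
next
  case True
  have "B (F (rev [1..<k + 1])) (F (rev [1..<k + 1])) = 1"
    using assms(4)
  proof (induction k)
    case 0
    then show ?case by (simp add: form_v[OF B])
  next
    case (Suc k)
    let ?I = "rev [1..<k + 1]"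
    have k: "Suc k \<in> {1..n}" and I: "set ?I \<subseteq> {1..n}" "Suc k \<notin> set ?I"
      using Suc.prems by auto
    have "(\<Sum>j\<leftarrow>?I. cartan_entry (Suc k) j) = (\<Sum>j\<in>{1..<k + 1}. cartan_entry (Suc k) j)"
      by (simp add: sum_list_distinct_conv_sum_set rev_map[symmetric] del: upt_Suc)
    also have "\<dots> = (\<Sum>j\<in>{1..<k + 1}. if j = k then - 1 else 0)"
      by (intro sum.cong) (auto simp: cartan_entry_def)
    also have "\<dots> = (if k = 0 then 0 else - 1)" by simp
    finally have "wt_coord n lam (Suc k) - (\<Sum>j\<leftarrow>?I. cartan_entry (Suc k) j) = 1"
      using wt k by simp
    then have ef: "e (Suc k) (F (Suc k # ?I)) = F ?I"
      using e_F_append[of "Suc k" "[]" ?I] k I by simp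
    have "B (F (Suc k # ?I)) (F (Suc k # ?I)) = B (F ?I) (F ?I)"
      using form_f[OF B k, of "F ?I"] ef by simp
    then show ?case using Suc by simp
  qed
  then show ?thesis using True by simp
qed

end

text \<open>Injectivity of \<open>t\<close> covers the differences of arbitrary parameters, since in
  an ordering any two letters can be adjacent.\<close>

locale bethe = highest_weight_rep n lam sc act v + critical n l t a
  for n lam and sc :: "complex \<Rightarrow> 'v \<Rightarrow> 'v::ab_group_add" and act v l t a +
  assumes l_wt: "l = wt_coord n lam"
    and t_inj: "inj_on t {1..n}"
begin

text \<open>The second bracket of omega_{I,k}: the convention \<open>t 0 = 1\<close> supplies the
  factor 1/(t_1 - 1).\<close>

definition step_prod :: "nat \<Rightarrow> complex" where
  "step_prod k = (\<Prod>s\<in>{1..k}. 1 / (t s - t (s - 1)))"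

text \<open>\<open>bethe_part q\<close> is the first tensor factor of the component of the Bethe vector on
  \<open>V \<otimes> f\<^sub>q \<cdots> f\<^sub>1 v\<^sub>0\<close>.\<close>

definition bethe_part :: "nat \<Rightarrow> 'v" where
  "bethe_part q = (\<Sum>I\<in>permutations_of_set {q + 1..n}. sc (chain_weight t I * step_prod q) (F I))"

lemma bethe_weight_eq: "bethe_weight I k t = chain_weight t I * step_prod k"
proof -
  have "(\<Prod>s\<in>{1..k - 1}. 1 / (t (s + 1) - t s)) * (1 / (t 1 - 1)) = step_prod k" if "k \<noteq> 0"
  proof -
    have "step_prod k = (\<Prod>s\<in>{1..Suc (k - 1)}. 1 / (t s - t (s - 1)))"
      using that by (simp add: step_prod_def)
    also have "\<dots> = (\<Prod>s\<in>{0..k - 1}. 1 / (t (Suc s) - t s))"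
      unfolding One_nat_def prod.shift_bounds_cl_Suc_ivl by simp
    also have "\<dots> = 1 / (t 1 - t 0) * (\<Prod>s\<in>{1..k - 1}. 1 / (t (Suc s) - t s))"
      by (simp add: prod.atLeast_Suc_atMost)
    finally show ?thesis by (simp add: t_0)
  qed
  then show ?thesis
    by (cases "I = []") (auto simp: bethe_weight_def chain_weight_eq step_prod_def mult_ac)
qed

lemma e_sum:
  assumes "i \<in> {1..n}"
  shows "e i (sum g S) = (\<Sum>x\<in>S. e i (g x))"
  by (rule linear_map_simps[OF linear_act[OF chev_sl(1)[OF assms]]])

text \<open>Together with the action of \<open>e\<^sub>i\<close> on the second factor this says that the Bethe vector is
  singular.\<close>

lemma e_bethe_part:
  assumes i: "i \<in> {q + 1..n}"
  shows "e i (bethe_part q) = (if i = q + 1 then sc (- 1) (bethe_part (q + 1)) else 0)"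
proof -
  have i1: "i \<in> {1..n}" using i by auto
  let ?S = "{q + 1..n} - {i}"
  let ?w = "\<lambda>J p. l i - (\<Sum>j\<leftarrow>drop p J. cartan_entry i j)"
  \<comment> \<open>Every position of \<open>i\<close> gives the same word \<open>F J\<close> after
    e_i has deleted it, so the coefficients add up.\<close>
  have inner: "(\<Sum>p\<le>length J. e i (sc (chain_weight t (insert_at p i J) * step_prod q) (F (insert_at p i J))))
      = sc (if i = q + 1 then - (chain_weight t J * step_prod (q + 1)) else 0) (F J)"
    if J: "J \<in> permutations_of_set ?S" for J
  proof -
    have sJ: "set J = ?S" "distinct J" using J by (auto dest: permutations_of_setD)
    have "e i (sc (chain_weight t (insert_at p i J) * step_prod q) (F (insert_at p i J)))
        = sc (step_prod q * (chain_weight t (insert_at p i J) * ?w J p)) (F J)" for p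
    proof -
      have "set (take p J @ i # drop p J) = insert i (set J)"
        using set_insert_at[of p i J] by (simp add: insert_at_def)
      moreover have "i \<notin> set (take p J)" "i \<notin> set (drop p J)"
        using sJ(1) set_take_subset[of p J] set_drop_subset[of p J] by auto
      ultimately have "e i (F (insert_at p i J)) = sc (?w J p) (F J)"
        unfolding insert_at_def using i1 sJ(1) by (subst e_F_append) (auto simp: l_wt)
      then show ?thesis
        by (simp add: act_scale[OF chev_sl(1)[OF i1]] mult_ac)
    qed
    then have "(\<Sum>p\<le>length J. e i (sc (chain_weight t (insert_at p i J) * step_prod q) (F (insert_at p i J))))
        = sc (step_prod q * (\<Sum>p\<le>length J. chain_weight t (insert_at p i J) * ?w J p)) (F J)"
      by (simp only: sum_distrib_left scale_sum_left)
    also have "(\<Sum>p\<le>length J. chain_weight t (insert_at p i J) * ?w J p)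
        = chain_weight t J * (l i / t i - (\<Sum>j\<in>set J. cartan_entry i j / (t i - t j)))"
    proof (rule sum_insert_at)
      have sub: "set (i # J) \<subseteq> {1..n}" using sJ i by auto
      then show "inj_on t (set (i # J))" by (rule inj_on_subset[OF t_inj])
      show "0 \<notin> t ` set (i # J)" using sub t_nz by (auto simp: subset_iff)
    qed (use sJ in auto)
    also have "(\<Sum>j\<in>set J. cartan_entry i j / (t i - t j))
        = (\<Sum>j\<in>set J. if j = Suc i then - (1 / (t i - t (Suc i)))
            else if j = i - 1 then - (1 / (t i - t (i - 1))) else 0)"
      using i1 sJ by (intro sum.cong refl) (auto simp: cartan_entry_def)
    \<comment> \<open>Only the neighbours of \<open>i\<close> have a nonzero Cartan entry. The upper
      one lies in \<open>J\<close> unless \<open>i = n\<close>, the lower one unless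
      \<open>i = q + 1\<close>.\<close>
    also have "\<dots> = (if i < n then - (1 / (t i - t (Suc i))) else 0)
        + (if i = q + 1 then 0 else - (1 / (t i - t (i - 1))))"
    proof -
      have "Suc i \<in> set J \<longleftrightarrow> i < n" "i - 1 \<in> set J \<longleftrightarrow> i \<noteq> q + 1" "Suc i \<noteq> i - 1"
        unfolding sJ(1) using i by auto
      then show ?thesis by (simp add: sum_if_two)
    qed
    \<comment> \<open>The critical equation cancels everything except the term of the neighbour
      \<open>q\<close> absent from \<open>J\<close>; it becomes the next factor of
      \<open>step_prod\<close>.\<close>
    also have "l i / t i - \<dots> = (if i = q + 1 then - (1 / (t i - t (i - 1))) else 0)"
    proof -
      have *: "x - ((if P then - y else 0) + (if Q then 0 else - z)) = (if Q then - z else 0)"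
        if "x + z + (if P then y else 0) = 0" for x y z :: complex and P Q
      proof -
        have "x = - (z + (if P then y else 0))"
          using that by (simp only: eq_neg_iff_add_eq_0 add.assoc)
        then show ?thesis by simp
      qed
      show ?thesis by (rule *[OF critical_eq[OF i1]])
    qed
    finally show ?thesis
      by (auto simp: step_prod_def)
  qed
  have "e i (bethe_part q) = (\<Sum>I\<in>permutations_of_set {q + 1..n}. e i (sc (chain_weight t I * step_prod q) (F I)))"
    unfolding bethe_part_def by (rule e_sum[OF i1])
  also have "\<dots> = (\<Sum>J\<in>permutations_of_set ?S. \<Sum>p\<le>length J.
      e i (sc (chain_weight t (insert_at p i J) * step_prod q) (F (insert_at p i J))))"
    using i by (intro sum_permutations_of_set_remove) auto
  also have "\<dots> = (\<Sum>J\<in>permutations_of_set ?S. sc (if i = q + 1 then - (chain_weight t J * step_prod (q + 1)) else 0) (F J))"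
    by (intro sum.cong refl inner)
  also have "\<dots> = (if i = q + 1 then sc (- 1) (bethe_part (q + 1)) else 0)"
  proof (cases "i = q + 1")
    case True
    then have "?S = {q + 1 + 1..n}" by auto
    then show ?thesis using True by (simp add: bethe_part_def scale_sum_right)
  qed simp
  finally show ?thesis .
qed

section \<open>Norms of the components of the Bethe vector\<close>

context
  fixes B
  assumes B: "shapovalov_form n sc act v B"
begin

text \<open>The leading letter passes to the left argument as a raising operator, where
  \<open>e_bethe_part\<close> forces it to be \<open>q + 1\<close> and gives a sign. At
  \<open>q = n\<close> only \<open>step_prod n\<close> times \<open>v\<close> is left.\<close>

lemma form_bethe_part_word:
  assumes "I \<in> permutations_of_set {q + 1..n}" "q \<le> n"
  shows "B (bethe_part q) (F I) = (if I = [q + 1..<n + 1] then (- 1) ^ (n - q) * step_prod n else 0)"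
  using assms
proof (induction I arbitrary: q)
  case Nil
  then have "{q + 1..n} = {}" using permutations_of_setD(1)[OF Nil(1)] by simp
  with Nil(2) have "q = n" by simp
  then show ?case
    by (simp add: bethe_part_def form_scale[OF B] form_v[OF B])
next
  case (Cons i I)
  then have sI: "insert i (set I) = {q + 1..n}" "i \<notin> set I" "distinct I"
    using permutations_of_setD[OF Cons.prems(1)] by simp_all
  then have i: "i \<in> {q + 1..n}" by auto
  then have q: "[q + 1..<n + 1] = (q + 1) # [q + 1 + 1..<n + 1]" by (subst upt_conv_Cons) auto
  have "B (bethe_part q) (F (i # I)) = B (e i (bethe_part q)) (F I)"
    using form_e[OF B, of i] i by simp
  also have "\<dots> = (if i = q + 1 then - B (bethe_part (q + 1)) (F I) else 0)"
    using form_scale(1)[OF B, of "- 1"] form_zero[OF B] by (simp only: e_bethe_part[OF i]) simp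
  also have "\<dots> = (if i # I = [q + 1..<n + 1] then (- 1) ^ (n - q) * step_prod n else 0)"
  proof (cases "i = q + 1")
    case True
    have "set I = {q + 1..n} - {q + 1}" using sI(1,2) True by blast
    also have "\<dots> = {q + 1 + 1..n}" by auto
    finally have "set I = {q + 1 + 1..n}" .
    then have "B (bethe_part (q + 1)) (F I) =
        (if I = [q + 1 + 1..<n + 1] then (- 1) ^ (n - (q + 1)) * step_prod n else 0)"
      using i sI(3) by (intro Cons.IH) (auto intro: permutations_of_setI)
    moreover have "n - q = Suc (n - (q + 1))" using i by auto
    ultimately show ?thesis using True unfolding q by simp
  next
    case False
    then show ?thesis unfolding q by simp
  qed
  finally show ?case .
qed

text \<open>Only one argument is expanded into words; of these, the increasing one alone pairs
  nontrivially with the other argument.\<close>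

lemma norm_bethe_part:
  assumes "q \<le> n"
  shows "B (bethe_part q) (bethe_part q)
    = chain_weight t [q + 1..<n + 1] * step_prod q * ((- 1) ^ (n - q) * step_prod n)"
proof -
  have "B (bethe_part q) (bethe_part q)
      = (\<Sum>I\<in>permutations_of_set {q + 1..n}. chain_weight t I * step_prod q * B (bethe_part q) (F I))"
    using form_sum[OF B, of "\<lambda>I. sc (chain_weight t I * step_prod q) (F I)" _ "bethe_part q"]
    by (subst (2) form_sym[OF B], subst (2) bethe_part_def)
      (simp add: form_scale[OF B] form_sym[OF B, of "bethe_part q"])
  also have "\<dots> = (\<Sum>I\<in>permutations_of_set {q + 1..n}. if I = [q + 1..<n + 1]
      then chain_weight t I * step_prod q * ((- 1) ^ (n - q) * step_prod n) else 0)"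
    using assms by (intro sum.cong refl) (simp add: form_bethe_part_word del: upt_Suc)
  also have "\<dots> = chain_weight t [q + 1..<n + 1] * step_prod q * ((- 1) ^ (n - q) * step_prod n)"
    by (subst sum.delta) (auto intro: permutations_of_setI simp del: upt_Suc)
  finally show ?thesis .
qed

text \<open>On increasing words the chain weight has the factors of \<open>step_prod\<close> with
  opposite sign; together they miss only the one for \<open>Suc q\<close>, which thus appears as
  \<open>t (Suc q) - t q\<close>. The empty word, \<open>q = n\<close>, has weight 1 and carries no
  1/t_n.\<close>

lemma chain_weight_interval:
  assumes "q \<le> n"
  shows "chain_weight t [q + 1..<n + 1] * step_prod q * (- 1) ^ (n - q)
    = (if q = n then step_prod n else - (t (Suc q) - t q) * step_prod n / t n)"
  using assms
proof (induction rule: inc_induct)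
  case base
  then show ?case by simp
next
  case (step q)
  have nz: "t (Suc q) - t q \<noteq> 0" using t_diff_nz[of "Suc q"] step by simp
  have sp: "step_prod (Suc q) * (t (Suc q) - t q) = step_prod q"
    using nz by (simp add: step_prod_def)
  have nq: "n - q = Suc (n - Suc q)" using step by simp
  show ?case
  \<comment> \<open>The induction hypothesis takes its exceptional form exactly when
    \<open>Suc q = n\<close>.\<close>
  proof (cases "Suc q = n")
    case True
    then show ?thesis using sp[symmetric] by auto
  next
    case False
    then have c: "[q + 1..<n + 1] = (q + 1) # (q + 2) # [q + 3..<n + 1]"
      "[Suc q + 1..<n + 1] = (q + 2) # [q + 3..<n + 1]"
      using step by (simp_all add: upt_conv_Cons numeral_3_eq_3)
    have nz': "t (Suc (Suc q)) - t (Suc q) \<noteq> 0"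
      using t_diff_nz[of "Suc (Suc q)"] step False by simp
    have "chain_weight t [q + 1..<n + 1] * step_prod q * (- 1) ^ (n - q)
        = chain_weight t [Suc q + 1..<n + 1] * step_prod (Suc q) * (- 1) ^ (n - Suc q)
          * ((t (Suc q) - t q) / (t (Suc (Suc q)) - t (Suc q)))"
      unfolding c nq sp[symmetric] using nz' by (simp add: divide_simps) (simp add: algebra_simps)
    also have "\<dots> = - (t (Suc q) - t q) * step_prod n / t n"
    proof -
      have *: "- d' * p / u * (d / d') = - d * p / u" if "d' \<noteq> 0" for d d' p u :: complex
        using that by simp
      show ?thesis unfolding step.IH if_not_P[OF False] by (rule *[OF nz'])
    qed
    finally show ?thesis using step by simp
  qed
qed

text \<open>Up to the square of \<open>step_prod n\<close>, the term \<open>q = n\<close> gives 1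
  and the others telescope to -(t_n - 1)/t_n, in total 1/t_n.\<close>

lemma sum_norm_bethe_part: "(\<Sum>q\<le>n. B (bethe_part q) (bethe_part q)) = (step_prod n)\<^sup>2 / t n"
proof -
  have "(\<Sum>q\<le>n. B (bethe_part q) (bethe_part q))
      = (\<Sum>q\<le>n. step_prod n * (if q = n then step_prod n else - (t (Suc q) - t q) * step_prod n / t n))"
    by (intro sum.cong refl) (simp add: norm_bethe_part chain_weight_interval[symmetric] mult_ac del: upt_Suc)
  also have "\<dots> = step_prod n * (step_prod n + (\<Sum>q<n. - (t (Suc q) - t q) * step_prod n / t n))"
    by (simp add: sum_distrib_left distrib_left flip: lessThan_Suc_atMost)
  also have "(\<Sum>q<n. - (t (Suc q) - t q) * step_prod n / t n) = - (\<Sum>q<n. t (Suc q) - t q) * (step_prod n / t n)"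
    by (simp add: sum_distrib_right sum_divide_distrib sum_negf[symmetric])
  also have "(\<Sum>q<n. t (Suc q) - t q) = t n - t 0" by (rule sum_lessThan_telescope)
  finally show ?thesis using t_nz[of n] by (simp add: t_0 power2_eq_square field_simps)
qed

end

end

section \<open>Reduction of the tensor product form to the first factor, and conclusion\<close>

lemma tensor_form_diagonal:
  assumes ten: "tensor_product s1 s2 s ten" and form: "tensor_form s ten B1 B2 B"
    and orth: "\<And>j k. j \<in> K \<Longrightarrow> k \<in> K \<Longrightarrow> B2 (y j) (y k) = (if j = k then 1 else 0)"
    and "finite K"
  shows "B (\<Sum>k\<in>K. ten (x k) (y k)) (\<Sum>k\<in>K. ten (x k) (y k)) = (\<Sum>k\<in>K. B1 (x k) (x k))"
proof -
  have lin: "Vector_Spaces.linear s (*) (\<lambda>u. B u w)" "Vector_Spaces.linear s (*) (B u)" for u w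
    using form by (auto simp: tensor_form_def bilinear_form_def bilinear_map_def)
  have "B (\<Sum>k\<in>K. ten (x k) (y k)) (\<Sum>k\<in>K. ten (x k) (y k))
      = (\<Sum>j\<in>K. \<Sum>k\<in>K. B (ten (x j) (y j)) (ten (x k) (y k)))"
    unfolding linear_map_simps(4)[OF lin(1)] unfolding linear_map_simps(4)[OF lin(2)] ..
  also have "\<dots> = (\<Sum>j\<in>K. \<Sum>k\<in>K. if j = k then B1 (x j) (x k) else 0)"
    using form by (intro sum.cong refl) (simp add: tensor_form_def orth)
  also have "\<dots> = (\<Sum>k\<in>K. B1 (x k) (x k))"
    using \<open>finite K\<close> by simp
  finally show ?thesis .
qed

text \<open>The denominators in \<open>crit_point\<close> serve as \<open>a\<close>; for index
  \<open>n + 1\<close> the empty sum makes the value 0.\<close>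

lemma critical_crit_point:
  assumes "\<forall>i\<in>{1..n}. (\<Sum>j\<in>{i..n}. l j) + of_nat n - of_nat i + 1 \<noteq> 0"
    and "\<forall>j\<in>{1..n}. crit_point n l j \<noteq> 0"
  shows "critical n l (crit_point n l) (\<lambda>i. (\<Sum>j\<in>{i..n}. l j) + of_nat n - of_nat i + 1)"
proof
  show "crit_point n l 0 = 1" by (simp add: crit_point_def)
  show "crit_point n l i \<noteq> 0" if "i \<le> n" for i
    using that assms(2) \<open>crit_point n l 0 = 1\<close> by (cases i) auto
  show "l i = ((\<Sum>j\<in>{i..n}. l j) + of_nat n - of_nat i + 1)
      - ((\<Sum>j\<in>{Suc i..n}. l j) + of_nat n - of_nat (Suc i) + 1) - 1" if "i \<in> {1..n}" for i
    using that by (simp add: sum.atLeast_Suc_atMost)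
  show "crit_point n l (Suc i) = crit_point n l i
      * (((\<Sum>j\<in>{Suc i..n}. l j) + of_nat n - of_nat (Suc i) + 1 - 1)
        / ((\<Sum>j\<in>{Suc i..n}. l j) + of_nat n - of_nat (Suc i) + 1))" for i
    by (simp add: crit_point_def)
qed (use assms in auto)

theorem theorem4:
  fixes n :: nat
    and lam om :: "complex mat \<Rightarrow> complex"
    and l t :: "nat \<Rightarrow> complex"
    and s1 :: "complex \<Rightarrow> 'u \<Rightarrow> 'u::ab_group_add"
    and act1 :: "complex mat \<Rightarrow> 'u \<Rightarrow> 'u" and v_lam :: 'u
    and s2 :: "complex \<Rightarrow> 'v \<Rightarrow> 'v::ab_group_add"
    and act2 :: "complex mat \<Rightarrow> 'v \<Rightarrow> 'v" and v0 :: 'v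
    and s :: "complex \<Rightarrow> 'w \<Rightarrow> 'w::ab_group_add"
    and ten :: "'u \<Rightarrow> 'v \<Rightarrow> 'w"
    and B1 :: "'u \<Rightarrow> 'u \<Rightarrow> complex" and B2 :: "'v \<Rightarrow> 'v \<Rightarrow> complex"
    and B :: "'w \<Rightarrow> 'w \<Rightarrow> complex"
    and L M :: "nat \<Rightarrow> complex \<Rightarrow> complex"
    and X :: 'w
  assumes "n \<ge> 1"
    and "weight n lam" and "l = wt_coord n lam"
    and "weight n om" and "\<forall>i\<in>{1..n}. wt_coord n om i = (if i = 1 then 1 else 0)"
    and "verma_module n lam s1 act1 v_lam"
    and "irreducible_hw_rep n om s2 act2 v0"
    and "vector_space s" and "tensor_product s1 s2 s ten"
    and "shapovalov_form n s1 act1 v_lam B1"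
    and "shapovalov_form n s2 act2 v0 B2"
    and "tensor_form s ten B1 B2 B"
    and "t = crit_point n l"
    and "\<forall>i\<in>{1..n}. (\<Sum>j\<in>{i..n}. l j) + of_nat n - of_nat i + 1 \<noteq> 0"
    and "\<forall>j\<in>{1..n}. t j \<noteq> 0" and "inj_on t {1..n}"
    and "X = bethe_vector n s ten act1 v_lam act2 v0 t"
    and "\<forall>j\<in>{1..n}. log_branch_at (t j) (L j)"
    and "log_branch_at (1 - t 1) (M 1)"
    and "\<forall>j\<in>{2..n}. log_branch_at (t j - t (j - 1)) (M j)"
  shows "B X X = Determinant.det (hessian n (ln_phase n l 1 L M) t)"
proof -
  let ?a = "\<lambda>i. (\<Sum>j\<in>{i..n}. l j) + of_nat n - of_nat i + 1"
  let ?v = "\<lambda>k. f_word n act2 (rev [1..<k + 1]) v0"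
  have crit: "critical n l t ?a"
    using critical_crit_point[OF assms(14)] assms(13,15) by blast
  interpret bethe n lam s1 act1 v_lam l t ?a
    using verma_highest_weight_rep[OF assms(6)] crit assms(3,16)
    by (intro bethe.intro bethe_axioms.intro)
  interpret V2: highest_weight_rep n om s2 act2 v0
    by (rule irreducible_highest_weight_rep[OF assms(7)])
  interpret log_branches n l t L M
    using assms(18-20) by unfold_locales auto
  have lin: "Vector_Spaces.linear s1 s (\<lambda>x. ten x y)" for y
    using assms(9) by (auto simp: tensor_product_def bilinear_map_def)
  have "X = (\<Sum>k\<le>n. ten (bethe_part k) (?v k))"
    unfolding assms(17) bethe_vector_def bethe_part_def linear_map_simps(4)[OF lin]
      linear_map_simps(2)[OF lin] bethe_weight_eq ..
  then have "B X X = (\<Sum>k\<le>n. B1 (bethe_part k) (bethe_part k))"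
    using tensor_form_diagonal[OF assms(9,12), of "{..n}" ?v bethe_part]
      V2.linear_rep_orthonormal[OF assms(11,5)] by simp
  also have "\<dots> = Determinant.det hess"
    unfolding sum_norm_bethe_part[OF assms(10)] det_hess_eq step_prod_def ..
  also have "hess = hessian n (ln_phase n l 1 L M) t"
  proof (rule eq_matI)
    fix i j assume "i < dim_row (hessian n (ln_phase n l 1 L M) t)"
      "j < dim_col (hessian n (ln_phase n l 1 L M) t)"
    then have ij: "i < n" "j < n" by (simp_all add: hessian_def)
    \<comment> \<open>Since \<open>t 0 = 1\<close>, the special first diagonal term with
      \<open>1 - t 1\<close> agrees with the general one after squaring.\<close>
    have "partial_deriv (i + 1) (partial_deriv (j + 1) (ln_phase n l 1 L M)) t = hess $$ (i, j)"
      using ij second_partials[of "i + 1" "j + 1"]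
      by (auto simp: hess_def t_0 power2_commute[of 1])
    then show "hess $$ (i, j) = hessian n (ln_phase n l 1 L M) t $$ (i, j)"
      using ij by (simp add: hessian_def)
  qed (simp_all add: hess_def hessian_def)
  finally show ?thesis .
qed

end
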